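(* Let $\lambda>0$, $c>0$, $p,q\ge 0$ with $p+q<1$, and let $(X(t),Y(t))$ be the planar random motion defined in the context. For every $t>0$, the measure $A\mapsto\mathbb{P}\big(X(t)\in A,\ Y(t)=0\big)$ on Borel subsets $A$ of $(-ct,ct)$ has the density $$g(x,t)=\frac{e^{-\lambda t}}{4c}\left[\lambda(1-p-q)\,I_0\left(\frac{\lambda}{c}(1-p-q)\sqrt{c^2t^2-x^2}\right)+\frac{\partial}{\partial t}I_0\left(\frac{\lambda}{c}(1-p-q)\sqrt{c^2t^2-x^2}\right)\right],\qquad |x|<ct,$$ where $I_0$ is the modified Bessel function of the first kind of order $0$.
   Context: Model. Let $d_j=(\cos(\pi j/2),\sin(\pi j/2))$, with index $j$ taken modulo 4. Let $N(t)$ be a homogeneous Poisson process of rate $\lambda$. The direction process $D(t)$ takes values in $\{d_0,d_1,d_2,d_3\}$; $D(0)$ is uniformly distributed and independent of $N$; $D$ is constant between Poisson events; at each Poisson event, independently of everything else, $D$ jumps from its current value $d_j$ to $d_{j+1}$ with probability $p$ (counterclockwise turn), to $d_{j-1}$ with probability $q$ (clockwise turn), and to $d_{j+2}$ with probability $1-p-q$ (reflection). The motion starts at the origin and has speed $c$: $(X(t),Y(t))=c\int_0^t D(\tau)\,d\tau$. *)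

theory Defs
  imports "HOL-Probability.Probability"
begin

text \<open>
  Counting paths are required for every sample point, not just almost surely; the natural
  subtraction in the increments is therefore never truncated.
\<close>

locale poisson_process = prob_space M
  for M :: "'a measure" and rate :: real and N :: "real \<Rightarrow> 'a \<Rightarrow> nat" +
  assumes count_measurable: "0 \<le> t \<Longrightarrow> random_variable (count_space UNIV) (N t)"
    and count_zero: "\<omega> \<in> space M \<Longrightarrow> N 0 \<omega> = 0"
    and count_mono: "\<omega> \<in> space M \<Longrightarrow> 0 \<le> s \<Longrightarrow> s \<le> t \<Longrightarrow> N s \<omega> \<le> N t \<omega>"
    and count_right_continuous:
      "\<omega> \<in> space M \<Longrightarrow> 0 \<le> t \<Longrightarrow> continuous (at_right t) (\<lambda>s. real (N s \<omega>))"
    and increment_distr: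
      "0 \<le> s \<Longrightarrow> s < t \<Longrightarrow>
        distr M (count_space UNIV) (\<lambda>\<omega>. N t \<omega> - N s \<omega>) = measure_pmf (poisson_pmf (rate * (t - s)))"
    and increment_indep:
      "0 \<le> ts 0 \<Longrightarrow> incseq ts \<Longrightarrow>
        indep_vars (\<lambda>_. count_space UNIV) (\<lambda>i \<omega>. N (ts (Suc i)) \<omega> - N (ts i) \<omega>) {..<n::nat}"

datatype source = Clock | Start | Turn nat

primrec source_events ::
  "'a measure \<Rightarrow> (real \<Rightarrow> 'a \<Rightarrow> nat) \<Rightarrow> ('a \<Rightarrow> int) \<Rightarrow> (nat \<Rightarrow> 'a \<Rightarrow> int) \<Rightarrow> source \<Rightarrow> 'a set set"
  where
    "source_events M N start turn Clock =
      sigma_sets (space M) {N t -` A \<inter> space M | t A. 0 \<le> t}"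
  | "source_events M N start turn Start = {start -` A \<inter> space M | A. True}"
  | "source_events M N start turn (Turn k) = {turn k -` A \<inter> space M | A. True}"

text \<open>
  The index of the initial direction is \<open>start\<close>, and \<open>turn k\<close> is the amount added to the index
  of the direction at the Poisson event number \<open>k + 1\<close>.
\<close>

locale planar_motion = poisson_process M rate N
  for M :: "'a measure" and rate :: real and N :: "real \<Rightarrow> 'a \<Rightarrow> nat" +
  fixes p q :: real and start :: "'a \<Rightarrow> int" and turn :: "nat \<Rightarrow> 'a \<Rightarrow> int"
  assumes start_measurable: "random_variable (count_space UNIV) start"
    and start_uniform:
      "distr M (count_space UNIV) start = measure_pmf (pmf_of_set {0, 1, 2, 3})"
    and turn_measurable: "random_variable (count_space UNIV) (turn k)"
    and turn_counterclockwise: "prob {\<omega> \<in> space M. turn k \<omega> = 1} = p"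
    and turn_clockwise: "prob {\<omega> \<in> space M. turn k \<omega> = - 1} = q"
    and turn_reflection: "prob {\<omega> \<in> space M. turn k \<omega> = 2} = 1 - p - q"
    and sources_indep: "indep_sets (source_events M N start turn) UNIV"

text \<open>Periodicity of the trigonometric functions takes care of the indices modulo 4.\<close>

definition dir :: "int \<Rightarrow> real \<times> real" where
  "dir j = (cos (pi * of_int j / 2), sin (pi * of_int j / 2))"

definition direction ::
  "(real \<Rightarrow> 'a \<Rightarrow> nat) \<Rightarrow> ('a \<Rightarrow> int) \<Rightarrow> (nat \<Rightarrow> 'a \<Rightarrow> int) \<Rightarrow> real \<Rightarrow> 'a \<Rightarrow> real \<times> real" where
  "direction N start turn t \<omega> = dir (start \<omega> + (\<Sum>k<N t \<omega>. turn k \<omega>))"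

definition position ::
  "real \<Rightarrow> (real \<Rightarrow> 'a \<Rightarrow> nat) \<Rightarrow> ('a \<Rightarrow> int) \<Rightarrow> (nat \<Rightarrow> 'a \<Rightarrow> int) \<Rightarrow> real \<Rightarrow> 'a \<Rightarrow> real \<times> real" where
  "position c N start turn t \<omega> = c *\<^sub>R integral {0..t} (\<lambda>\<tau>. direction N start turn \<tau> \<omega>)"

definition bessel_I0 :: "real \<Rightarrow> real" where
  "bessel_I0 z = (\<Sum>k. (z / 2) ^ (2 * k) / (fact k)\<^sup>2)"

definition axis_density :: "real \<Rightarrow> real \<Rightarrow> real \<Rightarrow> real \<Rightarrow> real \<Rightarrow> real \<Rightarrow> real" where
  "axis_density rate c p q x t =
    exp (- rate * t) / (4 * c) *
      (rate * (1 - p - q) * bessel_I0 (rate / c * (1 - p - q) * sqrt (c\<^sup>2 * t\<^sup>2 - x\<^sup>2))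
       + deriv (\<lambda>s. bessel_I0 (rate / c * (1 - p - q) * sqrt (c\<^sup>2 * s\<^sup>2 - x\<^sup>2))) t)"

end

theory Submission
  imports Defs
begin

text \<open>
  Conditioning on the last jump before \<open>t\<close> gives a renewal equation in \<open>n\<close> for the law of the occupation
  integral \<open>\<integral>\<^sub>0\<^sup>t f (N u) du\<close> on \<open>N t = n\<close>. By induction, this law has no atoms unless \<open>f\<close> is constant on
  \<open>{0..n}\<close>; hence \<open>Y t = 0\<close> forces, almost surely, a horizontal start and only reflections. In that
  case \<open>X\<close> is a telegraph process: for \<open>f k = (- 1) ^ k\<close> the renewal equation yields a scaled beta
  density on \<open>N t = n\<close>. Weighting it with \<open>(1 - p - q) ^ n / 4\<close>, adding the two horizontal starting
  directions and summing over \<open>n\<close> gives the Bessel series: odd \<open>n\<close> contribute \<open>I\<^sub>0\<close>, even \<open>n\<close> its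
  time derivative.
\<close>

subsection \<open>Jump times and occupation integrals\<close>

text \<open>The locale describes \<open>N\<close> only through increments between deterministic
  times, whereas an occupation integral is a function of the random jump times; neither exponential
  waiting times nor a joint law of the jumps is available at the start. The bridge is that for a
  jump time cut off at \<open>s\<close>, the event \<open>r < \<tau> k s\<close> just says
  \<open>r < s\<close> and \<open>N r < k\<close>, a statement about a fixed time. Strict lower
  bounds on finitely many coordinates are closed under intersection, so they determine the law of
  the whole sequence of cut-off jump times, and the event that the last jump comes after
  \<open>b\<close> becomes \<open>N b < N t\<close>, which independent increments can handle. The
  renewal equation treats a deterministic \<open>f\<close>, while the direction follows a random
  path of indices. Conditioning on that path is avoided: only finitely many of its values matter, so
  countably many integer lists cover all paths by one null set, and where all turns are reflections
  the path is determined by its start.\<close>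

lemma nonneg_eqI:
  fixes x y :: real
  assumes "0 \<le> x" "0 \<le> y" "\<And>r. 0 \<le> r \<Longrightarrow> r < x \<longleftrightarrow> r < y"
  shows "x = y"
  using assms by (metis linorder_neqE_linordered_idom order_less_irrefl)

context poisson_process
begin

text \<open>With \<open>S k\<close> the time of the event number \<open>k\<close>, this is \<open>min (S k) s\<close>; it is \<open>0\<close> for \<open>k = 0\<close>.\<close>

definition \<tau> :: "nat \<Rightarrow> real \<Rightarrow> 'a \<Rightarrow> real" where
  "\<tau> k s \<omega> = Sup (insert 0 {u \<in> {0..s}. N u \<omega> < k})"

lemma bdd_above_\<tau>: "bdd_above (insert 0 {u \<in> {0..s}. N u \<omega> < k})"
  by (auto intro!: bdd_aboveI[where M = s])

lemma eventually_constant_right: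
  assumes "\<omega> \<in> space M" "0 \<le> r"
  shows "\<forall>\<^sub>F u in at_right r. N u \<omega> = N r \<omega>"
proof -
  have "((\<lambda>s. real (N s \<omega>)) \<longlongrightarrow> real (N r \<omega>)) (at_right r)"
    using count_right_continuous[OF assms] by (simp add: continuous_within)
  then have "\<forall>\<^sub>F u in at_right r. dist (real (N u \<omega>)) (real (N r \<omega>)) < 1"
    by (rule tendstoD) simp
  then show ?thesis
    by (rule eventually_mono) (simp add: dist_real_def)
qed

text \<open>Right-continuity makes the bound strict: \<open>N\<close> keeps its value on some
  interval to the right of \<open>r\<close>, so the supremum exceeds \<open>r\<close>. Most facts
  about \<open>\<tau>\<close> below reduce to this equivalence.\<close>

lemma less_\<tau>_iff:
  assumes \<omega>: "\<omega> \<in> space M" and r: "0 \<le> r"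
  shows "r < \<tau> k s \<omega> \<longleftrightarrow> r < s \<and> N r \<omega> < k"
proof
  assume "r < \<tau> k s \<omega>"
  then obtain u where u: "u \<in> insert 0 {u \<in> {0..s}. N u \<omega> < k}" "r < u"
    unfolding \<tau>_def using less_cSup_iff[OF _ bdd_above_\<tau>] by blast
  with r have "u \<in> {0..s}" "N u \<omega> < k" by auto
  with u r \<omega> show "r < s \<and> N r \<omega> < k"
    using count_mono[OF \<omega> r, of u] by auto
next
  assume *: "r < s \<and> N r \<omega> < k"
  have "\<forall>\<^sub>F u in at_right r. N u \<omega> = N r \<omega> \<and> r < u \<and> u < s"
    using eventually_constant_right[OF \<omega> r] *
    by (intro eventually_conj eventually_at_right_less) (auto intro: eventually_at_rightI[of r s])
  then obtain u where u: "N u \<omega> = N r \<omega>" "r < u" "u < s"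
    using eventually_happens[of _ "at_right r"] trivial_limit_at_right_real by blast
  then show "r < \<tau> k s \<omega>"
    unfolding \<tau>_def using * r by (subst less_cSup_iff[OF _ bdd_above_\<tau>]) (auto intro!: exI[of _ u])
qed

lemma \<tau>_nonneg: "0 \<le> \<tau> k s \<omega>"
  unfolding \<tau>_def by (rule cSup_upper[OF _ bdd_above_\<tau>]) simp

lemma \<tau>_0 [simp]: "\<omega> \<in> space M \<Longrightarrow> \<tau> 0 s \<omega> = 0"
  by (rule nonneg_eqI) (auto simp: \<tau>_nonneg less_\<tau>_iff)

lemma \<tau>_eq_right: "\<omega> \<in> space M \<Longrightarrow> 0 \<le> s \<Longrightarrow> N s \<omega> < k \<Longrightarrow> \<tau> k s \<omega> = s"
  using count_mono
  by (intro nonneg_eqI) (auto simp: \<tau>_nonneg less_\<tau>_iff, meson less_le_not_le linorder_not_less order_trans less_imp_le)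

lemma \<tau>_le: "\<omega> \<in> space M \<Longrightarrow> 0 \<le> s \<Longrightarrow> \<tau> k s \<omega> \<le> s"
  using less_\<tau>_iff[of \<omega> s k s] by force

lemma \<tau>_mono: "\<omega> \<in> space M \<Longrightarrow> j \<le> k \<Longrightarrow> \<tau> j s \<omega> \<le> \<tau> k s \<omega>"
  using less_\<tau>_iff[of \<omega> "\<tau> k s \<omega>" j s] less_\<tau>_iff[of \<omega> "\<tau> k s \<omega>" k s] \<tau>_nonneg[of k s \<omega>]
  by force

lemma \<tau>_min: "\<omega> \<in> space M \<Longrightarrow> 0 \<le> u \<Longrightarrow> u \<le> s \<Longrightarrow> \<tau> k u \<omega> = min (\<tau> k s \<omega>) u"
  by (rule nonneg_eqI) (auto simp: \<tau>_nonneg less_\<tau>_iff)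

lemma count_eq_between:
  assumes "\<omega> \<in> space M" "\<tau> k s \<omega> < u" "u < \<tau> (Suc k) s \<omega>"
  shows "N u \<omega> = k"
proof -
  have "0 \<le> u" using \<tau>_nonneg[of k s \<omega>] assms by simp
  then show ?thesis
    using assms less_\<tau>_iff[of \<omega> u k s] less_\<tau>_iff[of \<omega> u "Suc k" s] by force
qed

text \<open>By right-continuity a jump is already counted at the jump time itself.\<close>

lemma count_\<tau>_ge:
  assumes "\<omega> \<in> space M" "0 \<le> s" "k \<le> N s \<omega>"
  shows "k \<le> N (\<tau> k s \<omega>) \<omega>"
  using less_\<tau>_iff[of \<omega> "\<tau> k s \<omega>" k s] \<tau>_nonneg[of k s \<omega>] \<tau>_le[of \<omega> s k] assms
  by (cases "\<tau> k s \<omega> = s") auto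

text \<open>Strictly between consecutive jump times the integrand is constant, so on each piece it
  can differ from \<open>F n\<close> only at the two endpoints. Values in a Euclidean space cover
  the planar direction at once.\<close>

lemma has_integral_count:
  fixes F :: "nat \<Rightarrow> 'b::euclidean_space"
  assumes \<omega>: "\<omega> \<in> space M"
  shows "((\<lambda>u. F (N u \<omega>)) has_integral (\<Sum>k<n. (\<tau> (Suc k) s \<omega> - \<tau> k s \<omega>) *\<^sub>R F k)) {0..\<tau> n s \<omega>}"
proof (induction n)
  case 0
  then show ?case using \<omega> has_integral_refl[of "\<lambda>u. F (N u \<omega>)" "0::real"] by simp
next
  case (Suc n)
  let ?a = "\<tau> n s \<omega>" and ?b = "\<tau> (Suc n) s \<omega>"
  have ab: "?a \<le> ?b" using \<tau>_mono[OF \<omega>] by simp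
  have "((\<lambda>u. F n) has_integral (?b - ?a) *\<^sub>R F n) {?a..?b}"
    using has_integral_const_real[of "F n" ?a ?b] ab by simp
  then have "((\<lambda>u. F (N u \<omega>)) has_integral (?b - ?a) *\<^sub>R F n) {?a..?b}"
    by (rule has_integral_spike_finite[where S = "{?a, ?b}", rotated 2])
       (auto intro!: arg_cong[where f = F] count_eq_between[OF \<omega>, where s = s])
  from has_integral_combine[OF \<tau>_nonneg ab Suc this] show ?case by simp
qed

text \<open>This is the integral of \<open>f (N u)\<close> over \<open>{0..s}\<close>. The last
  sojourn is cut at \<open>s\<close> without a separate term, since
  \<open>\<tau> (Suc (N s \<omega>)) s \<omega> = s\<close>.\<close>

definition occupation :: "(nat \<Rightarrow> real) \<Rightarrow> real \<Rightarrow> 'a \<Rightarrow> real" where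
  "occupation f s \<omega> = (\<Sum>k\<le>N s \<omega>. f k * (\<tau> (Suc k) s \<omega> - \<tau> k s \<omega>))"

lemma integral_count:
  fixes F :: "nat \<Rightarrow> 'b::euclidean_space"
  assumes \<omega>: "\<omega> \<in> space M" and s: "0 \<le> s"
  shows "integral {0..s} (\<lambda>u. F (N u \<omega>)) = (\<Sum>k\<le>N s \<omega>. (\<tau> (Suc k) s \<omega> - \<tau> k s \<omega>) *\<^sub>R F k)"
  using has_integral_count[OF \<omega>, where F = F and n = "Suc (N s \<omega>)" and s = s] \<tau>_eq_right[OF \<omega> s]
  by (simp add: lessThan_Suc_atMost integral_unique)

lemma occupation_const:
  assumes \<omega>: "\<omega> \<in> space M" and s: "0 \<le> s" and f: "\<And>k. k \<le> N s \<omega> \<Longrightarrow> f k = a"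
  shows "occupation f s \<omega> = a * s"
proof -
  have "occupation f s \<omega> = (\<Sum>k\<le>N s \<omega>. a * (\<tau> (Suc k) s \<omega> - \<tau> k s \<omega>))"
    unfolding occupation_def using f by simp
  also have "\<dots> = a * (\<Sum>k<Suc (N s \<omega>). (\<tau> (Suc k) s \<omega> - \<tau> k s \<omega>))"
    by (simp add: sum_distrib_left lessThan_Suc_atMost)
  also have "\<dots> = a * s"
    using \<tau>_eq_right[OF \<omega> s, of "Suc (N s \<omega>)"] \<omega> by (subst sum_lessThan_telescope) simp
  finally show ?thesis .
qed

section \<open>Increment probabilities and almost sure regularity of the jump times\<close>

lemma prob_increment:
  assumes "0 \<le> s" "s < t"
  shows "prob {\<omega> \<in> space M. N t \<omega> - N s \<omega> \<in> A} = measure (poisson_pmf (rate * (t - s))) A"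
proof -
  have m[measurable]: "N s \<in> measurable M (count_space UNIV)" "N t \<in> measurable M (count_space UNIV)"
    using assms by (auto intro!: count_measurable)
  have "measure (poisson_pmf (rate * (t - s))) A = measure (distr M (count_space UNIV) (\<lambda>\<omega>. N t \<omega> - N s \<omega>)) A"
    using increment_distr[OF assms] by simp
  also have "\<dots> = prob ((\<lambda>\<omega>. N t \<omega> - N s \<omega>) -` A \<inter> space M)"
    by (rule measure_distr) auto
  also have "(\<lambda>\<omega>. N t \<omega> - N s \<omega>) -` A \<inter> space M = {\<omega> \<in> space M. N t \<omega> - N s \<omega> \<in> A}" by auto
  finally show ?thesis by simp
qed

lemma prob_count_less:
  assumes "0 < rate" "0 \<le> s" "s < t"
  shows "prob {\<omega> \<in> space M. N s \<omega> < N t \<omega>} = 1 - exp (- rate * (t - s))"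
proof -
  have "{\<omega> \<in> space M. N s \<omega> < N t \<omega>} = {\<omega> \<in> space M. N t \<omega> - N s \<omega> \<in> UNIV - {0}}"
    using assms by auto
  then have "prob {\<omega> \<in> space M. N s \<omega> < N t \<omega>} = measure (poisson_pmf (rate * (t - s))) (UNIV - {0})"
    by (simp only: prob_increment[OF assms(2,3)])
  also have "\<dots> = 1 - measure (poisson_pmf (rate * (t - s))) {0}"
    using measure_pmf.prob_compl[of "{0}" "poisson_pmf (rate * (t - s))"] by simp
  also have "\<dots> = 1 - exp (- rate * (t - s))"
    using assms by (simp add: measure_pmf_single)
  finally show ?thesis .
qed

lemma count_less_in_events:
  assumes "0 \<le> s" "0 \<le> t"
  shows "{\<omega> \<in> space M. N s \<omega> < N t \<omega>} \<in> events"
proof -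
  have [measurable]: "N s \<in> measurable M (count_space UNIV)" "N t \<in> measurable M (count_space UNIV)"
    using assms by (auto intro!: count_measurable)
  have "{\<omega> \<in> space M. N s \<omega> < N t \<omega>} = {\<omega> \<in> space M. N t \<omega> - N s \<omega> \<noteq> 0}" by auto
  also have "\<dots> \<in> events" by measurable
  finally show ?thesis .
qed

text \<open>A bound of second order in the length: summed over \<open>m\<close> cells of length
  \<open>t / m\<close> it still tends to \<open>0\<close>. It rests on
  \<open>exp (- l) \<ge> 1 - l\<close>.\<close>

lemma prob_increment_ge_2:
  assumes "0 < rate" "0 \<le> s" "s < t"
  shows "prob {\<omega> \<in> space M. 2 \<le> N t \<omega> - N s \<omega>} \<le> (rate * (t - s))\<^sup>2"
proof -
  define l where "l = rate * (t - s)"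
  have l: "0 < l" using assms by (simp add: l_def)
  have "prob {\<omega> \<in> space M. 2 \<le> N t \<omega> - N s \<omega>} = measure (poisson_pmf l) (UNIV - {0, 1})"
  proof -
    have "{\<omega> \<in> space M. 2 \<le> N t \<omega> - N s \<omega>} = {\<omega> \<in> space M. N t \<omega> - N s \<omega> \<in> UNIV - {0, 1}}" by auto
    then show ?thesis by (simp only: prob_increment[OF assms(2,3)] l_def)
  qed
  also have "\<dots> = 1 - measure (poisson_pmf l) {0, 1}"
    using measure_pmf.prob_compl[of "{0, 1}" "poisson_pmf l"] by simp
  also have "measure (poisson_pmf l) {0, 1} = (1 + l) * exp (- l)"
    using l pmf_poisson[OF l, of 0] pmf_poisson[OF l, of 1]
    by (subst measure_measure_pmf_finite) (auto simp del: pmf_poisson simp: algebra_simps)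
  finally have "prob {\<omega> \<in> space M. 2 \<le> N t \<omega> - N s \<omega>} = 1 - (1 + l) * exp (- l)" .
  moreover have "(1 + l) * (1 - l) \<le> (1 + l) * exp (- l)"
    using l exp_ge_add_one_self[of "- l"] by (intro mult_left_mono) auto
  moreover have "(1 + l) * (1 - l) = 1 - l\<^sup>2"
    by (simp add: algebra_simps power2_eq_square)
  ultimately show ?thesis unfolding l_def[symmetric] by linarith
qed

text \<open>A jump at exactly \<open>s\<close> would put an event between \<open>r\<close> and
  \<open>s\<close> for every earlier \<open>r\<close>; that probability,
  \<open>1 - exp (- rate * (s - r))\<close>, vanishes as \<open>r\<close> increases to
  \<open>s\<close>.\<close>

lemma AE_no_jump_at:
  assumes "0 < rate" "0 < s"
  shows "AE \<omega> in M. \<exists>r. 0 \<le> r \<and> r < s \<and> N r \<omega> = N s \<omega>"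
proof -
  define r where "r j = s - s / real (Suc j)" for j
  have r: "0 \<le> r j" "r j < s" for j
    using assms by (auto simp: r_def field_simps)
  have sets_less: "{\<omega> \<in> space M. N (r j) \<omega> < N s \<omega>} \<in> events" for j
    using count_less_in_events[OF r(1) less_imp_le[OF assms(2)]] .
  let ?B = "{\<omega> \<in> space M. \<forall>j. N (r j) \<omega> < N s \<omega>}"
  have le: "prob ?B \<le> 1 - exp (- rate * (s - r j))" for j
    unfolding prob_count_less[OF assms(1) r, symmetric]
    by (rule finite_measure_mono) (use sets_less in auto)
  have "(\<lambda>j. 1 - exp (- rate * (s * inverse (real (Suc j))))) \<longlonglongrightarrow> 1 - exp (- rate * (s * 0))"
    by (intro tendsto_intros LIMSEQ_inverse_real_of_nat)
  moreover have "s - r j = s * inverse (real (Suc j))" for j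
    by (simp add: r_def divide_inverse)
  ultimately have "(\<lambda>j. 1 - exp (- rate * (s - r j))) \<longlonglongrightarrow> 0" by simp
  then have "prob ?B \<le> 0"
    by (rule LIMSEQ_le_const) (use le in blast)
  then have "prob ?B = 0" using measure_nonneg[of M ?B] by linarith
  then have "emeasure M ?B = 0" by (simp only: emeasure_eq_measure ennreal_0)
  then have "?B \<in> null_sets M"
    by (rule null_setsI) (rule sets.sets_Collect_countable_All[OF sets_less])
  then have "AE \<omega> in M. \<omega> \<notin> ?B" by (rule AE_not_in)
  with AE_space show ?thesis
  proof eventually_elim
    case (elim \<omega>)
    then obtain j where "\<not> N (r j) \<omega> < N s \<omega>" by auto
    with count_mono[of \<omega> "r j" s] elim r[of j] show ?case
      by (intro exI[of _ "r j"]) auto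
  qed
qed

text \<open>The union bound over \<open>m\<close> equal cells gives probability at most
  \<open>(rate * t)\<^sup>2 / m\<close> that some cell holds two events. Failure for all
  \<open>m\<close> at once therefore has probability \<open>0\<close>.\<close>

lemma AE_simple_cells:
  assumes rt: "0 < rate" and t: "0 < t"
  shows "AE \<omega> in M. \<exists>m>0. \<forall>i<m. N (real (Suc i) * t / real m) \<omega> - N (real i * t / real m) \<omega> < 2"
proof -
  define g where "g m i = real i * t / real m" for m i
  have g: "0 \<le> g m i" for m i
    using t by (auto simp: g_def)
  have gl: "g m i < g m (Suc i)" "g m (Suc i) - g m i = t / m" if "m > 0" for m i
    using t that by (auto simp: g_def field_simps)
  have m[measurable]: "N (g m i) \<in> measurable M (count_space UNIV)" for m i
    using g by (auto intro!: count_measurable)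
  let ?D = "\<lambda>m i. {\<omega> \<in> space M. 2 \<le> N (g m (Suc i)) \<omega> - N (g m i) \<omega>}"
  let ?B = "{\<omega> \<in> space M. \<forall>m>0. \<exists>i<m. 2 \<le> N (g m (Suc i)) \<omega> - N (g m i) \<omega>}"
  have le: "prob ?B \<le> (rate * t)\<^sup>2 * inverse (real (Suc j))" for j
  proof -
    let ?m = "Suc j"
    have "prob ?B \<le> prob (\<Union>i<?m. ?D ?m i)"
      by (rule finite_measure_mono) auto
    also have "\<dots> \<le> (\<Sum>i<?m. prob (?D ?m i))"
      by (rule finite_measure_subadditive_finite) auto
    also have "\<dots> \<le> (\<Sum>i<?m. (rate * (t / ?m))\<^sup>2)"
      using prob_increment_ge_2[OF rt g gl(1)] gl(2) by (intro sum_mono) (metis zero_less_Suc)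
    also have "\<dots> = (rate * t)\<^sup>2 * inverse (real (Suc j))"
      by (simp add: field_simps power2_eq_square del: of_nat_Suc)
    finally show ?thesis .
  qed
  have "(\<lambda>j. (rate * t)\<^sup>2 * inverse (real (Suc j))) \<longlonglongrightarrow> (rate * t)\<^sup>2 * 0"
    by (intro tendsto_intros LIMSEQ_inverse_real_of_nat)
  then have "prob ?B \<le> 0"
    using le by (intro LIMSEQ_le_const[where X = "\<lambda>j. (rate * t)\<^sup>2 * inverse (real (Suc j))"]) auto
  then have "prob ?B = 0" using measure_nonneg[of M ?B] by linarith
  then have "?B \<in> null_sets M"
    by (intro null_setsI) (auto simp: emeasure_eq_measure)
  then have "AE \<omega> in M. \<omega> \<notin> ?B" by (rule AE_not_in)
  with AE_space show ?thesis
    by eventually_elim (auto simp: g_def not_le)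
qed

text \<open>Two jumps coinciding at \<open>u\<close> put two events into the cell around
  \<open>u\<close>, however fine the partition, which \<open>AE_simple_cells\<close>
  excludes.\<close>

lemma AE_\<tau>_strict:
  assumes rt: "0 < rate" and t: "0 < t"
  shows "AE \<omega> in M. \<forall>k. Suc k \<le> N t \<omega> \<longrightarrow> \<tau> k t \<omega> < \<tau> (Suc k) t \<omega>"
  using AE_simple_cells[OF rt t] AE_space
proof eventually_elim
  case (elim \<omega>)
  then have \<omega>: "\<omega> \<in> space M" by simp
  from elim obtain m where m: "m > 0"
    and cell: "\<And>i. i < m \<Longrightarrow> N (real (Suc i) * t / real m) \<omega> - N (real i * t / real m) \<omega> < 2" by auto
  show ?case
  proof (intro allI impI, rule ccontr)
    fix k assume k: "Suc k \<le> N t \<omega>" and "\<not> \<tau> k t \<omega> < \<tau> (Suc k) t \<omega>"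
    define u where "u = \<tau> (Suc k) t \<omega>"
    have u: "\<tau> k t \<omega> = u"
      using \<open>\<not> _\<close> \<tau>_mono[OF \<omega>, of k "Suc k" t] by (simp add: u_def)
    have u0: "0 < u" using less_\<tau>_iff[OF \<omega>, of 0 "Suc k" t] count_zero[OF \<omega>] t by (simp add: u_def)
    have ut: "u \<le> t" using \<tau>_le[OF \<omega>] t by (simp add: u_def)
    \<comment> \<open>Selects the cell, open on the left and closed on the right, that contains
      \<open>u\<close>: fewer than \<open>k\<close> events are counted at its left end and at least
      \<open>Suc k\<close> at its right end.\<close>
    define i where "i = nat (\<lceil>u * m / t\<rceil> - 1)"
    have c1: "1 \<le> \<lceil>u * m / t\<rceil>" using u0 m t by (simp add: le_ceiling_iff)
    have ri: "real i = \<lceil>u * m / t\<rceil> - 1" using c1 by (simp add: i_def)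
    have i1: "real i < u * m / t" "u * m / t \<le> real (Suc i)"
      using ri by linarith+
    have "u * m / t \<le> m" using ut t m by (simp add: field_simps)
    then have im: "i < m" using i1 by simp
    have a: "real i * t / m < u" "u \<le> real (Suc i) * t / m"
      using i1 t m by (simp_all add: field_simps)
    have "N (real i * t / m) \<omega> < k"
      using less_\<tau>_iff[OF \<omega>, of "real i * t / m" k t] a(1) u t by simp
    moreover have "Suc k \<le> N u \<omega>" using count_\<tau>_ge[OF \<omega> _ k] t by (simp add: u_def)
    moreover have "N u \<omega> \<le> N (real (Suc i) * t / m) \<omega>" using count_mono[OF \<omega> _ a(2)] u0 by simp
    ultimately show False using cell[OF im] by linarith
  qed
qed

end

section \<open>Independence of a later increment from the past\<close>

lemma measurable_sum_nat:
  fixes f :: "'i \<Rightarrow> 'b \<Rightarrow> nat"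
  assumes "\<And>i. i \<in> I \<Longrightarrow> f i \<in> measurable M (count_space UNIV)"
  shows "(\<lambda>x. \<Sum>i\<in>I. f i x) \<in> measurable M (count_space UNIV)"
  using assms by (induction I rule: infinite_finite_induct) auto

context poisson_process
begin

text \<open>Each \<open>N a\<close> with \<open>(k, a) \<in> F\<close> is a partial sum of
  increments over a grid inside \<open>{0..b}\<close>, and the increment from \<open>b\<close> to
  \<open>t\<close> is independent of all of these.\<close>

lemma prob_future_past:
  assumes F: "finite F" "\<And>k a. (k, a) \<in> F \<Longrightarrow> 0 \<le> a \<and> a \<le> b" and b: "0 \<le> b" "b < t"
  shows "prob {\<omega> \<in> space M. N b \<omega> < N t \<omega> \<and> (\<forall>(k, a)\<in>F. N a \<omega> < k)} =
    prob {\<omega> \<in> space M. N b \<omega> < N t \<omega>} * prob {\<omega> \<in> space M. \<forall>(k, a)\<in>F. N a \<omega> < k}"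
proof -
  define xs where "xs = sorted_list_of_set (snd ` F)"
  define n where "n = length xs"
  \<comment> \<open>The grid runs through \<open>0\<close>, the sorted times of \<open>F\<close> and
    \<open>b\<close>, then stays at \<open>t\<close>, because the independence assumption takes an
    infinite monotone sequence. Increment \<open>Suc n\<close> leads from \<open>b\<close> to
    \<open>t\<close>; those up to \<open>n\<close> are the past.\<close>
  define ts where "ts i = (if i = 0 then 0 else if i \<le> n then xs ! (i - 1) else if i = Suc n then b else t)" for i
  have set_xs: "set xs = snd ` F" using F by (simp add: xs_def)
  have xs_b: "0 \<le> xs ! i \<and> xs ! i \<le> b" if "i < n" for i
    using nth_mem[of i xs] that F(2) unfolding set_xs n_def by force
  have inc: "incseq ts"
  proof (rule incseq_SucI)
    fix i
    show "ts i \<le> ts (Suc i)"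
      using xs_b[of i] xs_b[of "i - 1"] b sorted_nth_mono[of xs "i - 1" i]
      by (auto simp: ts_def n_def xs_def)
  qed
  have ts_nonneg: "0 \<le> ts i" for i
    using incseqD[OF inc, of 0 i] by (simp add: ts_def)
  define X where "X i \<omega> = N (ts (Suc i)) \<omega> - N (ts i) \<omega>" for i \<omega>
  have sum_X: "(\<Sum>i<j. X i \<omega>) = N (ts j) \<omega>" if "\<omega> \<in> space M" for j \<omega>
  proof (induction j)
    case 0
    then show ?case using count_zero[OF that] by (simp add: ts_def)
  next
    case (Suc j)
    then show ?case
      using count_mono[OF that ts_nonneg, of j "ts (Suc j)"] inc by (simp add: X_def incseq_SucD)
  qed
  have "\<forall>a\<in>snd ` F. \<exists>j. j \<le> n \<and> ts j = a"
  proof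
    fix a assume "a \<in> snd ` F"
    then obtain i where "i < n" "xs ! i = a" unfolding set_xs[symmetric] n_def by (metis in_set_conv_nth)
    then show "\<exists>j. j \<le> n \<and> ts j = a" by (intro exI[of _ "Suc i"]) (simp add: ts_def)
  qed
  then obtain idx where idx: "\<And>k a. (k, a) \<in> F \<Longrightarrow> idx a \<le> n \<and> ts (idx a) = a"
    by (metis snd_conv image_eqI)
  have ind: "indep_vars (\<lambda>_. count_space UNIV) X {..<Suc (Suc n)}"
    unfolding X_def by (rule increment_indep[OF ts_nonneg inc])
  let ?P = "PiM {..n} (\<lambda>_. count_space UNIV :: nat measure)"
  let ?P' = "PiM {Suc n} (\<lambda>_. count_space UNIV :: nat measure)"
  have iv: "indep_var ?P (\<lambda>\<omega>. restrict (\<lambda>i. X i \<omega>) {..n}) ?P' (\<lambda>\<omega>. restrict (\<lambda>i. X i \<omega>) {Suc n})"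
    by (rule indep_var_restrict[OF ind]) auto
  let ?A = "{g \<in> space ?P. \<forall>(k, a)\<in>F. (\<Sum>i<idx a. g i) < k}"
  let ?B = "{g \<in> space ?P'. g (Suc n) \<noteq> 0}"
  have A: "?A \<in> sets ?P"
  proof -
    have "{g \<in> space ?P. (\<Sum>i<idx a. g i) < k} \<in> sets ?P" if "(k, a) \<in> F" for k a
    proof -
      have [measurable]: "(\<lambda>g. g i) \<in> measurable ?P (count_space UNIV)" if "i < idx a" for i
        using that idx[OF \<open>(k, a) \<in> F\<close>] by (intro measurable_component_singleton) auto
      have [measurable]: "(\<lambda>g. \<Sum>i<idx a. g i) \<in> measurable ?P (count_space UNIV)"
        by (rule measurable_sum_nat) auto
      have "{g \<in> space ?P. (\<Sum>i<idx a. g i) < k} = (\<lambda>g. \<Sum>i<idx a. g i) -` {..<k} \<inter> space ?P" by auto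
      also have "\<dots> \<in> sets ?P" by measurable
      finally show ?thesis .
    qed
    then show ?thesis using F(1) by (intro sets.sets_Collect_finite_All) auto
  qed
  have B: "?B \<in> sets ?P'" by measurable
  have eA: "(\<lambda>\<omega>. restrict (\<lambda>i. X i \<omega>) {..n}) -` ?A \<inter> space M = {\<omega> \<in> space M. \<forall>(k, a)\<in>F. N a \<omega> < k}"
  proof -
    have "(\<Sum>i<idx a. restrict (\<lambda>i. X i \<omega>) {..n} i) = N a \<omega>" if "(k, a) \<in> F" "\<omega> \<in> space M" for k a \<omega>
    proof -
      have "(\<Sum>i<idx a. restrict (\<lambda>i. X i \<omega>) {..n} i) = (\<Sum>i<idx a. X i \<omega>)"
        using idx[OF that(1)] by (intro sum.cong) auto
      then show ?thesis using sum_X[OF that(2)] idx[OF that(1)] by simp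
    qed
    then show ?thesis by (auto simp: space_PiM)
  qed
  have eB: "(\<lambda>\<omega>. restrict (\<lambda>i. X i \<omega>) {Suc n}) -` ?B \<inter> space M = {\<omega> \<in> space M. N b \<omega> < N t \<omega>}"
    by (auto simp: space_PiM X_def ts_def)
  have "prob {\<omega> \<in> space M. N b \<omega> < N t \<omega> \<and> (\<forall>(k, a)\<in>F. N a \<omega> < k)} =
    prob ((\<lambda>\<omega>. (restrict (\<lambda>i. X i \<omega>) {..n}, restrict (\<lambda>i. X i \<omega>) {Suc n})) -` (?A \<times> ?B) \<inter> space M)"
    using eA eB by (intro arg_cong[where f = prob]) blast
  also have "\<dots> = prob {\<omega> \<in> space M. \<forall>(k, a)\<in>F. N a \<omega> < k} * prob {\<omega> \<in> space M. N b \<omega> < N t \<omega>}"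
    unfolding indep_varD[OF iv A B] eA eB ..
  finally show ?thesis by simp
qed

end

subsection \<open>The last jump\<close>

definition above :: "(nat \<times> real) set \<Rightarrow> (nat \<Rightarrow> real) set" where
  "above F = {v. \<forall>(k, a)\<in>F. a < v k}"

text \<open>Only the sigma-algebra matters; it is the product one on real sequences. The generators
  are strict lower bounds because these are the events that \<open>less_\<tau>_iff\<close> turns
  into conditions on counts at fixed times.\<close>

definition paths :: "(nat \<Rightarrow> real) measure" where
  "paths = sigma UNIV {above F |F. finite F}"

lemma space_paths [simp]: "space paths = UNIV"
  by (simp add: paths_def space_measure_of_conv)

lemma sets_paths: "sets paths = sigma_sets UNIV {above F |F. finite F}"
  unfolding paths_def by (rule sets_measure_of) auto

lemma measurable_paths_component: "(\<lambda>v. v k) \<in> borel_measurable paths"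
  unfolding borel_measurable_iff_greater
proof
  fix a
  have "{v \<in> space paths. a < v k} = above {(k, a)}" by (auto simp: above_def)
  also have "\<dots> \<in> sets paths" unfolding sets_paths by (intro sigma_sets.Basic) blast
  finally show "{v \<in> space paths. a < v k} \<in> sets paths" .
qed

lemma measurable_pathsI:
  assumes "\<And>k. (\<lambda>x. f x k) \<in> borel_measurable M"
  shows "f \<in> measurable M paths"
  unfolding paths_def
proof (rule measurable_measure_of)
  fix Y assume "Y \<in> {above F |F. finite F}"
  then obtain F where F: "finite F" "Y = above F" by auto
  note [measurable] = assms
  have "f -` Y \<inter> space M = {x \<in> space M. \<forall>ka\<in>F. snd ka < f x (fst ka)}"
    by (auto simp: F above_def)
  also have "\<dots> \<in> sets M"
    using F(1) by (intro sets.sets_Collect_finite_All) measurable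
  finally show "f -` Y \<inter> space M \<in> sets M" .
qed auto

lemma Int_stable_above: "Int_stable {above F |F. finite F}"
proof (rule Int_stableI)
  fix A B assume "A \<in> {above F |F. finite F}" "B \<in> {above F |F. finite F}"
  then obtain F G where "finite F" "A = above F" "finite G" "B = above G" by auto
  then show "A \<inter> B \<in> {above F |F. finite F}"
    by (auto intro!: exI[of _ "F \<union> G"] simp: above_def)
qed

text \<open>The counterpart of \<open>prob_count_less\<close>: the density of the last jump,
  integrated over the times after \<open>b\<close>, gives the probability of
  \<open>N b < N t\<close>.\<close>

lemma nn_integral_exp:
  fixes r b t :: real
  assumes "0 < r" "0 \<le> b" "b < t"
  shows "(\<integral>\<^sup>+s. indicator {0<..<t} s * ennreal (r * exp (- r * (t - s))) * indicator {b<..} s \<partial>lborel) =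
    ennreal (1 - exp (- r * (t - b)))"
proof -
  have "(\<integral>\<^sup>+s. indicator {0<..<t} s * ennreal (r * exp (- r * (t - s))) * indicator {b<..} s \<partial>lborel) =
      (\<integral>\<^sup>+s. ennreal (r * exp (- r * (t - s))) * indicator {b..t} s \<partial>lborel)"
  proof (rule nn_integral_cong_AE)
    show "AE s in lborel. indicator {0<..<t} s * ennreal (r * exp (- r * (t - s))) * indicator {b<..} s =
        ennreal (r * exp (- r * (t - s))) * indicator {b..t} s"
      using AE_lborel_singleton[of b] AE_lborel_singleton[of t]
      by eventually_elim (use assms in \<open>auto split: split_indicator\<close>)
  qed
  also have "\<dots> = ennreal (exp (- r * (t - t)) - exp (- r * (t - b)))"
    using assms
    by (intro nn_integral_FTC_Icc[where F = "\<lambda>s. exp (- r * (t - s))"])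
       (auto intro!: derivative_eq_intros)
  finally show ?thesis by simp
qed

context poisson_process
begin

text \<open>The index \<open>0\<close> is free, as \<open>\<tau> 0 s = 0\<close>; it carries the horizon \<open>s\<close> itself.\<close>

definition arrivals :: "real \<Rightarrow> 'a \<Rightarrow> nat \<Rightarrow> real" where
  "arrivals s \<omega> k = (if k = 0 then s else \<tau> k s \<omega>)"

text \<open>On \<open>N t \<omega> = 0\<close> the value is \<open>0\<close>, which does not stand
  for a jump; hence the condition \<open>0 < N t \<omega>\<close> in the law below.\<close>

definition last_jump :: "real \<Rightarrow> 'a \<Rightarrow> real" where
  "last_jump t \<omega> = \<tau> (N t \<omega>) t \<omega>"

lemma count_le_in_events: "0 \<le> a \<Longrightarrow> {\<omega> \<in> space M. N a \<omega> < k} \<in> events"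
  using measurable_sets[OF count_measurable[of a], of "{..<k}"]
  by (simp add: vimage_def Int_def conj_commute)

text \<open>Joint measurability is immediate because, by \<open>less_\<tau>_iff\<close>, a
  superlevel set at \<open>a \<ge> 0\<close> is a rectangle.\<close>

lemma measurable_\<tau>: "(\<lambda>(s, \<omega>). \<tau> k s \<omega>) \<in> borel_measurable (borel \<Otimes>\<^sub>M M)"
  unfolding borel_measurable_iff_greater
proof
  fix a
  show "{x \<in> space (borel \<Otimes>\<^sub>M M). a < (case x of (s, \<omega>) \<Rightarrow> \<tau> k s \<omega>)} \<in> sets (borel \<Otimes>\<^sub>M M)"
  proof (cases "0 \<le> a")
    case True
    have "{x \<in> space (borel \<Otimes>\<^sub>M M). a < (case x of (s, \<omega>) \<Rightarrow> \<tau> k s \<omega>)} =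
      {a<..} \<times> {\<omega> \<in> space M. N a \<omega> < k}"
      using less_\<tau>_iff[OF _ True] by (auto simp: space_pair_measure)
    then show ?thesis using count_le_in_events[OF True] by auto
  next
    case False
    then have "{x \<in> space (borel \<Otimes>\<^sub>M M). a < (case x of (s, \<omega>) \<Rightarrow> \<tau> k s \<omega>)} = space (borel \<Otimes>\<^sub>M M)"
      using less_le_trans[OF _ \<tau>_nonneg, of a] by auto
    then show ?thesis by auto
  qed
qed

lemma measurable_\<tau>_fixed [measurable]: "\<tau> k s \<in> borel_measurable M"
  using measurable_compose[OF measurable_Pair1' measurable_\<tau>, of s k] by simp

lemma measurable_arrivals: "(\<lambda>(s, \<omega>). arrivals s \<omega>) \<in> measurable (borel \<Otimes>\<^sub>M M) paths"
proof (rule measurable_pathsI)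
  fix k show "(\<lambda>x. (case x of (s, \<omega>) \<Rightarrow> arrivals s \<omega>) k) \<in> borel_measurable (borel \<Otimes>\<^sub>M M)"
    using measurable_\<tau>[of k] by (cases "k = 0") (simp_all add: arrivals_def split_beta)
qed

lemma measurable_arrivals_fixed [measurable]: "arrivals s \<in> measurable M paths"
  using measurable_compose[OF measurable_Pair1' measurable_arrivals, of s] by simp

lemma less_last_jump_iff:
  "\<omega> \<in> space M \<Longrightarrow> 0 \<le> r \<Longrightarrow> r < last_jump t \<omega> \<longleftrightarrow> r < t \<and> N r \<omega> < N t \<omega>"
  by (simp add: last_jump_def less_\<tau>_iff)

lemma measurable_last_jump [measurable]:
  assumes "0 \<le> t"
  shows "last_jump t \<in> borel_measurable M"
  unfolding borel_measurable_iff_greater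
proof
  fix a
  show "{\<omega> \<in> space M. a < last_jump t \<omega>} \<in> events"
  proof (cases "0 \<le> a")
    case True
    have "{\<omega> \<in> space M. a < last_jump t \<omega>} = (if a < t then {\<omega> \<in> space M. N a \<omega> < N t \<omega>} else {})"
      using less_last_jump_iff[OF _ True] by auto
    then show ?thesis using count_less_in_events[OF True assms] by auto
  next
    case False
    then have "{\<omega> \<in> space M. a < last_jump t \<omega>} = space M"
      using less_le_trans[OF _ \<tau>_nonneg, of a] by (auto simp: last_jump_def)
    then show ?thesis by auto
  qed
qed

lemma measurable_arrivals_last_jump [measurable]:
  assumes "0 \<le> t"
  shows "(\<lambda>\<omega>. arrivals (last_jump t \<omega>) \<omega>) \<in> measurable M paths"
proof -
  have "(\<lambda>\<omega>. (last_jump t \<omega>, \<omega>)) \<in> measurable M (borel \<Otimes>\<^sub>M M)"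
    using measurable_last_jump[OF assms] by measurable
  from measurable_compose[OF this measurable_arrivals] show ?thesis by simp
qed

text \<open>By \<open>less_\<tau>_iff\<close> a bound \<open>a \<ge> 0\<close> on coordinate
  \<open>k > 0\<close> splits into \<open>a < s\<close> and \<open>N a < k\<close>, while coordinate
  \<open>0\<close> contributes only \<open>a < s\<close>. The largest bound \<open>b\<close> absorbs
  all conditions on \<open>s\<close>. Negative bounds hold trivially, hence the \<open>0\<close> in
  the maximum and the restriction in \<open>G\<close>.\<close>

lemma arrivals_above_iff:
  assumes "finite F"
  obtains b G where "0 \<le> b" "finite G" "\<And>k a. (k, a) \<in> G \<Longrightarrow> 0 \<le> a \<and> a \<le> b"
    "\<And>(s::real) \<omega>. \<omega> \<in> space M \<Longrightarrow> 0 < s \<Longrightarrow> arrivals s \<omega> \<in> above F \<longleftrightarrow> b < s \<and> (\<forall>(k, a)\<in>G. N a \<omega> < k)"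
proof -
  define b where "b = Max (insert 0 (snd ` F))"
  define G where "G = {(k, a) \<in> F. k \<noteq> 0 \<and> 0 \<le> a}"
  have b: "0 \<le> b" "a \<le> b" if "(k, a) \<in> F" for k a
    unfolding b_def using assms that by (auto intro!: Max_ge image_eqI[of _ snd])
  have b0: "0 \<le> b" unfolding b_def using assms by (auto intro!: Max_ge)
  have b_in: "b = 0 \<or> (\<exists>k. (k, b) \<in> F)"
    using Max_in[of "insert 0 (snd ` F)"] assms unfolding b_def by auto
  show thesis
  proof (rule that[of b G])
    show "finite G" using assms by (rule finite_subset[rotated]) (auto simp: G_def)
    show "0 \<le> a \<and> a \<le> b" if "(k, a) \<in> G" for k a using that b by (auto simp: G_def)
  next
    fix s :: real and \<omega> assume \<omega>: "\<omega> \<in> space M" and s: "0 < s"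
    have arr_le: "0 \<le> arrivals s \<omega> k \<and> arrivals s \<omega> k \<le> s" for k
      using s \<tau>_le[OF \<omega>, of s k] \<tau>_nonneg[of k s \<omega>] by (simp add: arrivals_def)
    show "arrivals s \<omega> \<in> above F \<longleftrightarrow> b < s \<and> (\<forall>(k, a)\<in>G. N a \<omega> < k)"
    proof
      assume *: "arrivals s \<omega> \<in> above F"
      have "b < s"
        using b_in
      proof
        assume "\<exists>k. (k, b) \<in> F"
        then obtain k where "b < arrivals s \<omega> k" using * by (auto simp: above_def)
        then show "b < s" using arr_le[of k] by simp
      qed (use s in simp)
      moreover have "N a \<omega> < k" if "(k, a) \<in> G" for k a
        using that * less_\<tau>_iff[OF \<omega>, of a k s] by (auto simp: G_def above_def arrivals_def)
      ultimately show "b < s \<and> (\<forall>(k, a)\<in>G. N a \<omega> < k)" by auto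
    next
      assume *: "b < s \<and> (\<forall>(k, a)\<in>G. N a \<omega> < k)"
      have "a < arrivals s \<omega> k" if F: "(k, a) \<in> F" for k a
      proof (cases "a < 0")
        case True
        then show ?thesis using arr_le[of k] by simp
      next
        case False
        then have "a < s" using b(2)[OF F] * by simp
        then show ?thesis
          using False less_\<tau>_iff[OF \<omega>, of a k s] * F by (auto simp: arrivals_def G_def)
      qed
      then show "arrivals s \<omega> \<in> above F" by (auto simp: above_def)
    qed
  qed (rule b0)
qed

text \<open>The last jump before \<open>t\<close> occurs after \<open>b\<close> iff \<open>N b < N t\<close>, which is independent of the path up
  to \<open>b\<close>. By \<open>arrivals_above_iff\<close>, the generating events of \<open>paths\<close> all have the form \<open>b < s\<close> together with a
  condition on the path up to \<open>b\<close>, so the two laws agree on an intersection-stable generator.\<close>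

lemma last_jump_law:
  assumes rt: "0 < rate" and t: "0 < t" and X: "X \<in> sets paths"
  shows "emeasure M {\<omega> \<in> space M. 0 < N t \<omega> \<and> arrivals (last_jump t \<omega>) \<omega> \<in> X} =
    (\<integral>\<^sup>+s. indicator {0<..<t} s * ennreal (rate * exp (- rate * (t - s))) *
      emeasure M {\<omega> \<in> space M. arrivals s \<omega> \<in> X} \<partial>lborel)"
proof -
  let ?h = "\<lambda>s. indicator {0<..<t} s * ennreal (rate * exp (- rate * (t - s)))"
  let ?S = "{\<omega> \<in> space M. 0 < N t \<omega>}"
  have Nt[measurable]: "N t \<in> measurable M (count_space UNIV)" using t by (intro count_measurable) simp
  have S: "?S \<in> events"
    using measurable_sets[OF Nt, of "{0<..}"] by (simp add: vimage_def Int_def conj_commute)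
  \<comment> \<open>\<open>\<mu>\<close> is the law of the jump times cut at the last jump,
    restricted to \<open>0 < N t\<close>; \<open>\<nu>\<close> is their law when the horizon is
    drawn independently of \<open>N\<close> from the sub-probability density
    \<open>?h\<close>.\<close>
  define \<mu> where "\<mu> = distr (density M (indicator ?S)) paths (\<lambda>\<omega>. arrivals (last_jump t \<omega>) \<omega>)"
  define \<nu> where "\<nu> = distr (density lborel ?h \<Otimes>\<^sub>M M) paths (\<lambda>(s, \<omega>). arrivals s \<omega>)"
  note mL = measurable_arrivals_last_jump[OF less_imp_le[OF t]]
  have \<mu>: "emeasure \<mu> Y = emeasure M {\<omega> \<in> space M. 0 < N t \<omega> \<and> arrivals (last_jump t \<omega>) \<omega> \<in> Y}"
    if Y: "Y \<in> sets paths" for Y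
  proof -
    have "emeasure \<mu> Y = emeasure (density M (indicator ?S)) ((\<lambda>\<omega>. arrivals (last_jump t \<omega>) \<omega>) -` Y \<inter> space M)"
      unfolding \<mu>_def using mL Y by (subst emeasure_distr) auto
    also have "\<dots> = emeasure M (?S \<inter> ((\<lambda>\<omega>. arrivals (last_jump t \<omega>) \<omega>) -` Y \<inter> space M))"
      using S measurable_sets[OF mL Y] by (rule emeasure_restricted)
    also have "?S \<inter> ((\<lambda>\<omega>. arrivals (last_jump t \<omega>) \<omega>) -` Y \<inter> space M) =
        {\<omega> \<in> space M. 0 < N t \<omega> \<and> arrivals (last_jump t \<omega>) \<omega> \<in> Y}" by auto
    finally show ?thesis .
  qed
  have marr: "(\<lambda>(s, \<omega>). arrivals s \<omega>) \<in> measurable (density lborel ?h \<Otimes>\<^sub>M M) paths"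
    using measurable_arrivals
    by (subst measurable_cong_sets[OF sets_pair_measure_cong[of _ borel _ M] refl]) auto
  have \<nu>: "emeasure \<nu> Y = (\<integral>\<^sup>+s. ?h s * emeasure M {\<omega> \<in> space M. arrivals s \<omega> \<in> Y} \<partial>lborel)"
    if Y: "Y \<in> sets paths" for Y
  proof -
    let ?Z = "(\<lambda>(s, \<omega>). arrivals s \<omega>) -` Y \<inter> space (density lborel ?h \<Otimes>\<^sub>M M)"
    have Z: "?Z \<in> sets (density lborel ?h \<Otimes>\<^sub>M M)" by (rule measurable_sets[OF marr Y])
    have Z': "?Z \<in> sets (lborel \<Otimes>\<^sub>M M)"
      using Z sets_pair_measure_cong[of "density lborel ?h" lborel M M] by simp
    have "emeasure \<nu> Y = emeasure (density lborel ?h \<Otimes>\<^sub>M M) ?Z"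
      unfolding \<nu>_def by (rule emeasure_distr[OF marr Y])
    also have "\<dots> = (\<integral>\<^sup>+s. emeasure M (Pair s -` ?Z) \<partial>density lborel ?h)"
      by (rule emeasure_pair_measure_alt[OF Z])
    also have "\<dots> = (\<integral>\<^sup>+s. ?h s * emeasure M (Pair s -` ?Z) \<partial>lborel)"
      by (rule nn_integral_density[OF _ measurable_emeasure_Pair[OF Z']]) simp
    finally have "emeasure \<nu> Y = (\<integral>\<^sup>+s. ?h s * emeasure M ((\<lambda>s. Pair s -` ?Z) s) \<partial>lborel)" .
    also have "(\<lambda>s. Pair s -` ?Z) = (\<lambda>s. {\<omega> \<in> space M. arrivals s \<omega> \<in> Y})"
      by (auto simp: space_pair_measure)
    finally show ?thesis .
  qed
  have gen: "emeasure \<mu> (above F) = emeasure \<nu> (above F)" if F: "finite F" for F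
  proof -
    from arrivals_above_iff[OF F] obtain b G where bG: "0 \<le> b" "finite G"
      "\<And>k a. (k, a) \<in> G \<Longrightarrow> 0 \<le> a \<and> a \<le> b" and
      iff: "\<And>s \<omega>. \<omega> \<in> space M \<Longrightarrow> 0 < s \<Longrightarrow> arrivals s \<omega> \<in> above F \<longleftrightarrow> b < s \<and> (\<forall>(k, a)\<in>G. N a \<omega> < k)"
      by metis
    have Fs: "above F \<in> sets paths" unfolding sets_paths using F by (intro sigma_sets.Basic) blast
    let ?E = "{\<omega> \<in> space M. \<forall>(k, a)\<in>G. N a \<omega> < k}"
    \<comment> \<open>Supplies the positive horizon that \<open>iff\<close> requires.\<close>
    have pos: "0 < N t \<omega> \<longleftrightarrow> 0 < last_jump t \<omega>" if "\<omega> \<in> space M" for \<omega>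
      using less_last_jump_iff[OF that, of 0 t] count_zero[OF that] t by simp
    have "{\<omega> \<in> space M. 0 < N t \<omega> \<and> arrivals (last_jump t \<omega>) \<omega> \<in> above F} =
      {\<omega> \<in> space M. b < last_jump t \<omega> \<and> (\<forall>(k, a)\<in>G. N a \<omega> < k)}"
      using iff pos bG(1) by (auto intro: le_less_trans)
    also have "\<dots> = {\<omega> \<in> space M. b < t \<and> N b \<omega> < N t \<omega> \<and> (\<forall>(k, a)\<in>G. N a \<omega> < k)}"
      using less_last_jump_iff[OF _ bG(1)] by auto
    finally have 1: "emeasure \<mu> (above F) =
        emeasure M {\<omega> \<in> space M. b < t \<and> N b \<omega> < N t \<omega> \<and> (\<forall>(k, a)\<in>G. N a \<omega> < k)}"
      using \<mu>[OF Fs] by simp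
    have 2: "emeasure \<nu> (above F) = (\<integral>\<^sup>+s. (?h s * indicator {b<..} s) * emeasure M ?E \<partial>lborel)"
      unfolding \<nu>[OF Fs]
    proof (rule nn_integral_cong)
      fix s :: real
      have "{\<omega> \<in> space M. arrivals s \<omega> \<in> above F} = (if b < s then ?E else {})" if "0 < s"
        using iff[OF _ that] by auto
      then show "?h s * emeasure M {\<omega> \<in> space M. arrivals s \<omega> \<in> above F} =
          (?h s * indicator {b<..} s) * emeasure M ?E"
        by (auto split: split_indicator)
    qed
    show ?thesis
    proof (cases "b < t")
      case True
      have "emeasure \<nu> (above F) = ennreal (1 - exp (- rate * (t - b))) * emeasure M ?E"
      proof -
        have meas: "(\<lambda>s. ?h s * indicator {b<..} s) \<in> borel_measurable lborel" by auto
        show ?thesis unfolding 2 nn_integral_multc[OF meas] nn_integral_exp[OF rt bG(1) True] ..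
      qed
      also have "\<dots> = emeasure \<mu> (above F)"
      proof -
        have "prob {\<omega> \<in> space M. N b \<omega> < N t \<omega> \<and> (\<forall>(k, a)\<in>G. N a \<omega> < k)} =
          (1 - exp (- rate * (t - b))) * prob ?E"
          unfolding prob_count_less[OF rt bG(1) True, symmetric]
          by (rule prob_future_past) (use bG True in auto)
        moreover have "0 \<le> 1 - exp (- rate * (t - b))" using rt True by simp
        ultimately show ?thesis
          unfolding 1 using True by (simp add: emeasure_eq_measure ennreal_mult del: mult_minus_left)
      qed
      finally show ?thesis by simp
    next
      case False
      have "emeasure \<nu> (above F) = (\<integral>\<^sup>+(s::real). 0 \<partial>lborel)"
        unfolding 2 using False by (intro nn_integral_cong) (auto split: split_indicator)
      then show ?thesis using False 1 by simp
    qed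
  qed
  have "\<mu> = \<nu>"
  proof (rule measure_eqI_generator_eq[OF Int_stable_above, where A = "\<lambda>_. UNIV" and \<Omega> = UNIV])
    have "above {} = UNIV" by (simp add: above_def)
    then show "range (\<lambda>_. UNIV) \<subseteq> {above F |F. finite F}" by (auto intro!: exI[of _ "{}"])
    show "emeasure \<mu> X = emeasure \<nu> X" if "X \<in> {above F |F. finite F}" for X using that gen by auto
    show "sets \<mu> = sigma_sets UNIV {above F |F. finite F}" "sets \<nu> = sigma_sets UNIV {above F |F. finite F}"
      by (simp_all add: \<mu>_def \<nu>_def sets_paths)
    show "emeasure \<mu> UNIV \<noteq> \<infinity>" for i :: nat
      using \<mu>[of UNIV] sets.top[of paths] by (simp add: emeasure_eq_measure)
  qed auto
  then show ?thesis using \<mu>[OF X] \<nu>[OF X] by simp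
qed


section \<open>The renewal equation for the occupation integral and its atoms\<close>

lemma measurable_occupation [measurable]:
  assumes "0 \<le> s"
  shows "occupation f s \<in> borel_measurable M"
proof -
  have "(\<lambda>\<omega>. \<Sum>k\<le>N s \<omega>. f k * (\<tau> (Suc k) s \<omega> - \<tau> k s \<omega>)) \<in> borel_measurable M"
    by (rule measurable_compose_countable[OF _ count_measurable[OF assms]]) measurable
  then show ?thesis unfolding occupation_def[abs_def] .
qed

lemma count_eq_occupation_in_events:
  assumes "0 \<le> s" "B \<in> sets borel"
  shows "{\<omega> \<in> space M. N s \<omega> = n \<and> occupation f s \<omega> + c \<in> B} \<in> events"
proof -
  note [measurable] = count_measurable[OF assms(1)] measurable_occupation[OF assms(1)] assms(2)
  show ?thesis by measurable
qed

text \<open>The conditions on \<open>\<tau>\<close> say that exactly \<open>n\<close> jumps come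
  strictly before \<open>s\<close>; \<open>r\<close> witnesses that no jump falls on
  \<open>s\<close>, so this is the full count.\<close>

lemma count_eq_iff_\<tau>:
  assumes \<omega>: "\<omega> \<in> space M" and s: "0 < s" and r: "0 \<le> r" "r < s" "N r \<omega> = N s \<omega>"
  shows "\<tau> n s \<omega> < s \<and> \<tau> (Suc n) s \<omega> = s \<longleftrightarrow> N s \<omega> = n"
proof
  assume *: "\<tau> n s \<omega> < s \<and> \<tau> (Suc n) s \<omega> = s"
  have "N s \<omega> \<le> n" using less_\<tau>_iff[OF \<omega> r(1), of "Suc n" s] r * by simp
  moreover have "n \<le> N (\<tau> n s \<omega>) \<omega>"
    using less_\<tau>_iff[OF \<omega> \<tau>_nonneg, of n s \<omega> n s] * by simp
  moreover have "N (\<tau> n s \<omega>) \<omega> \<le> N s \<omega>"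
    using count_mono[OF \<omega> \<tau>_nonneg] * by simp
  ultimately show "N s \<omega> = n" by simp
next
  assume "N s \<omega> = n"
  then show "\<tau> n s \<omega> < s \<and> \<tau> (Suc n) s \<omega> = s"
    using \<tau>_eq_right[OF \<omega>, of s "Suc n"] less_\<tau>_iff[OF \<omega> r(1), of n s] r s by simp
qed

text \<open>The same conditions as in \<open>count_eq_iff_\<tau>\<close>, but the horizon
  \<open>R\<close> is now itself a jump: \<open>n\<close> jumps come strictly before
  \<open>R\<close> and \<open>R\<close> adds one more. The assumption \<open>strict\<close> excludes
  several jumps at \<open>R\<close>.\<close>

lemma last_jump_\<tau>:
  assumes \<omega>: "\<omega> \<in> space M" and t: "0 < t"
    and strict: "\<And>k. Suc k \<le> N t \<omega> \<Longrightarrow> \<tau> k t \<omega> < \<tau> (Suc k) t \<omega>"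
  defines "R \<equiv> last_jump t \<omega>"
  shows "0 < N t \<omega> \<and> \<tau> n R \<omega> < R \<and> \<tau> (Suc n) R \<omega> = R \<longleftrightarrow> N t \<omega> = Suc n"
proof -
  have R: "0 \<le> R" "R \<le> t" "R = \<tau> (N t \<omega>) t \<omega>"
    using \<tau>_nonneg \<tau>_le[OF \<omega>] t by (auto simp: R_def last_jump_def)
  have min: "\<tau> k R \<omega> = min (\<tau> k t \<omega>) R" for k
    by (rule \<tau>_min[OF \<omega> R(1,2)])
  show ?thesis
  proof
    assume *: "0 < N t \<omega> \<and> \<tau> n R \<omega> < R \<and> \<tau> (Suc n) R \<omega> = R"
    have "\<not> N t \<omega> \<le> n" using \<tau>_mono[OF \<omega>, of "N t \<omega>" n t] R(3) * min[of n] by auto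
    moreover have "\<not> Suc (Suc n) \<le> N t \<omega>"
    proof
      assume 2: "Suc (Suc n) \<le> N t \<omega>"
      then have "\<tau> (Suc n) t \<omega> < R"
        using strict[OF 2] \<tau>_mono[OF \<omega> 2, of t] R(3) by simp
      then show False using * min[of "Suc n"] by auto
    qed
    ultimately show "N t \<omega> = Suc n" by simp
  next
    assume "N t \<omega> = Suc n"
    then show "0 < N t \<omega> \<and> \<tau> n R \<omega> < R \<and> \<tau> (Suc n) R \<omega> = R"
      using strict[of n] R(3) min by simp
  qed
qed

lemma occupation_last_jump:
  assumes \<omega>: "\<omega> \<in> space M" and t: "0 < t" and n: "N t \<omega> = Suc n"
  defines "R \<equiv> last_jump t \<omega>"
  shows "occupation f t \<omega> = (\<Sum>k\<le>n. f k * (\<tau> (Suc k) R \<omega> - \<tau> k R \<omega>)) + f (Suc n) * (t - R)"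
proof -
  have R: "0 \<le> R" "R \<le> t" "R = \<tau> (Suc n) t \<omega>"
    using \<tau>_nonneg \<tau>_le[OF \<omega>] t n by (auto simp: R_def last_jump_def)
  have "\<tau> k R \<omega> = \<tau> k t \<omega>" if "k \<le> Suc n" for k
    using \<tau>_min[OF \<omega> R(1,2), of k] \<tau>_mono[OF \<omega> that, of t] R(3) by simp
  then have "(\<Sum>k\<le>n. f k * (\<tau> (Suc k) R \<omega> - \<tau> k R \<omega>)) = (\<Sum>k\<le>n. f k * (\<tau> (Suc k) t \<omega> - \<tau> k t \<omega>))"
    by (intro sum.cong) auto
  then show ?thesis
    using \<tau>_eq_right[OF \<omega>, of t "Suc (Suc n)"] t n R(3) by (simp add: occupation_def)
qed

text \<open>\<open>last_jump_law\<close> trades the last jump for an independent horizon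
  \<open>s\<close>. Up to null sets, one set \<open>C\<close> of cut-off sequences means
  \<open>N t = Suc n\<close> at the last jump (\<open>last_jump_\<tau>\<close>) but
  \<open>N s = n\<close> at a fixed \<open>s\<close> (\<open>count_eq_iff_\<tau>\<close>). The
  summand \<open>f (Suc n) * (t - s)\<close> is the final sojourn.\<close>

lemma occupation_renewal:
  assumes rt: "0 < rate" and t: "0 < t" and B[measurable]: "B \<in> sets borel"
  shows "emeasure M {\<omega> \<in> space M. N t \<omega> = Suc n \<and> occupation f t \<omega> \<in> B} =
    (\<integral>\<^sup>+s. indicator {0<..<t} s * ennreal (rate * exp (- rate * (t - s))) *
      emeasure M {\<omega> \<in> space M. N s \<omega> = n \<and> occupation f s \<omega> + f (Suc n) * (t - s) \<in> B} \<partial>lborel)"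
proof -
  define c where "c k v = v k" for k :: nat and v :: "nat \<Rightarrow> real"
  \<comment> \<open>Coordinate \<open>0\<close> of \<open>arrivals\<close> holds the horizon, so
    \<open>z\<close> restores the value of \<open>\<tau> 0 s\<close>.\<close>
  define z where "z k v = (if k = 0 then 0 else v k)" for k :: nat and v :: "nat \<Rightarrow> real"
  have [measurable]: "c k \<in> borel_measurable paths" "z k \<in> borel_measurable paths" for k
    unfolding c_def[abs_def] z_def[abs_def]
    using measurable_paths_component[of k] by (cases "k = 0", simp_all)
  have z_arrivals: "z k (arrivals s \<omega>) = \<tau> k s \<omega>" if "\<omega> \<in> space M" for s \<omega> k
    using that by (simp add: z_def arrivals_def)
  define C where "C = {v \<in> space paths. z n v < c 0 v \<and> c (Suc n) v - c 0 v \<in> {0} \<and>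
    (\<Sum>k\<le>n. f k * (c (Suc k) v - z k v)) + f (Suc n) * (t - c 0 v) \<in> B}"
  have C: "C \<in> sets paths" unfolding C_def by measurable
  have arr: "arrivals s \<omega> \<in> C \<longleftrightarrow> \<tau> n s \<omega> < s \<and> \<tau> (Suc n) s \<omega> = s \<and>
     (\<Sum>k\<le>n. f k * (\<tau> (Suc k) s \<omega> - \<tau> k s \<omega>)) + f (Suc n) * (t - s) \<in> B" if "\<omega> \<in> space M" for s \<omega>
    by (simp add: C_def z_arrivals[OF that]) (simp add: c_def arrivals_def)
  have "emeasure M {\<omega> \<in> space M. N t \<omega> = Suc n \<and> occupation f t \<omega> \<in> B} =
      emeasure M {\<omega> \<in> space M. 0 < N t \<omega> \<and> arrivals (last_jump t \<omega>) \<omega> \<in> C}"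
  proof (rule emeasure_eq_AE)
    show "AE \<omega> in M. \<omega> \<in> {\<omega> \<in> space M. N t \<omega> = Suc n \<and> occupation f t \<omega> \<in> B} \<longleftrightarrow>
        \<omega> \<in> {\<omega> \<in> space M. 0 < N t \<omega> \<and> arrivals (last_jump t \<omega>) \<omega> \<in> C}"
      using AE_\<tau>_strict[OF rt t] AE_space
    proof eventually_elim
      case (elim \<omega>)
      then show ?case
        using last_jump_\<tau>[of \<omega> t n] occupation_last_jump[of \<omega> t n f] arr[of \<omega> "last_jump t \<omega>"] t
        by auto
    qed
    show "{\<omega> \<in> space M. N t \<omega> = Suc n \<and> occupation f t \<omega> \<in> B} \<in> events"
      using count_eq_occupation_in_events[of t B "Suc n" f 0] t B by simp
    have [measurable]: "N t \<in> measurable M (count_space UNIV)"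
      "(\<lambda>\<omega>. arrivals (last_jump t \<omega>) \<omega>) \<in> measurable M paths" "C \<in> sets paths"
      using t C by (auto intro!: count_measurable)
    have "{\<omega> \<in> space M. N t \<omega> \<noteq> 0 \<and> arrivals (last_jump t \<omega>) \<omega> \<in> C} \<in> events"
      by measurable
    then show "{\<omega> \<in> space M. 0 < N t \<omega> \<and> arrivals (last_jump t \<omega>) \<omega> \<in> C} \<in> events"
      by simp
  qed
  also have "\<dots> = (\<integral>\<^sup>+s. indicator {0<..<t} s * ennreal (rate * exp (- rate * (t - s))) *
      emeasure M {\<omega> \<in> space M. arrivals s \<omega> \<in> C} \<partial>lborel)"
    by (rule last_jump_law[OF rt t C])
  also have "\<dots> = (\<integral>\<^sup>+s. indicator {0<..<t} s * ennreal (rate * exp (- rate * (t - s))) *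
      emeasure M {\<omega> \<in> space M. N s \<omega> = n \<and> occupation f s \<omega> + f (Suc n) * (t - s) \<in> B} \<partial>lborel)"
  proof (rule nn_integral_cong)
    fix s :: real
    show "indicator {0<..<t} s * ennreal (rate * exp (- rate * (t - s))) *
      emeasure M {\<omega> \<in> space M. arrivals s \<omega> \<in> C} =
      indicator {0<..<t} s * ennreal (rate * exp (- rate * (t - s))) *
      emeasure M {\<omega> \<in> space M. N s \<omega> = n \<and> occupation f s \<omega> + f (Suc n) * (t - s) \<in> B}"
    proof (cases "s \<in> {0<..<t}")
      case True
      then have s: "0 < s" by simp
      have "emeasure M {\<omega> \<in> space M. arrivals s \<omega> \<in> C} =
        emeasure M {\<omega> \<in> space M. N s \<omega> = n \<and> occupation f s \<omega> + f (Suc n) * (t - s) \<in> B}"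
      proof (rule emeasure_eq_AE)
        show "AE \<omega> in M. \<omega> \<in> {\<omega> \<in> space M. arrivals s \<omega> \<in> C} \<longleftrightarrow>
            \<omega> \<in> {\<omega> \<in> space M. N s \<omega> = n \<and> occupation f s \<omega> + f (Suc n) * (t - s) \<in> B}"
          using AE_no_jump_at[OF rt s] AE_space
        proof eventually_elim
          case (elim \<omega>)
          then obtain r where "0 \<le> r" "r < s" "N r \<omega> = N s \<omega>" by auto
          then show ?case
            using count_eq_iff_\<tau>[of \<omega> s r n] elim s arr[of \<omega> s] by (auto simp: occupation_def)
        qed
        show "{\<omega> \<in> space M. arrivals s \<omega> \<in> C} \<in> events"
          using measurable_sets[OF measurable_arrivals_fixed[of s] C]
          by (simp add: vimage_def Int_def conj_commute)
      qed (use s B in \<open>auto intro!: count_eq_occupation_in_events\<close>)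
      then show ?thesis by simp
    qed simp
  qed
  finally show ?thesis .
qed

lemma occupation_no_atom:
  assumes rt: "0 < rate" and t: "0 < t" and f: "j \<le> n" "k \<le> n" "f j \<noteq> f k"
  shows "emeasure M {\<omega> \<in> space M. N t \<omega> = n \<and> occupation f t \<omega> = x} = 0"
  using t f
proof (induction n arbitrary: j k t x)
  case 0
  then show ?case by simp
next
  case (Suc n)
  let ?P = "\<lambda>s. emeasure M {\<omega> \<in> space M. N s \<omega> = n \<and> occupation f s \<omega> + f (Suc n) * (t - s) \<in> {x}}"
  have "emeasure M {\<omega> \<in> space M. N t \<omega> = Suc n \<and> occupation f t \<omega> \<in> {x}} =
    (\<integral>\<^sup>+s. indicator {0<..<t} s * ennreal (rate * exp (- rate * (t - s))) * ?P s \<partial>lborel)"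
    by (rule occupation_renewal[OF rt Suc.prems(1)]) simp
  also have "\<dots> = (\<integral>\<^sup>+(s::real). 0 \<partial>lborel)"
  proof (rule nn_integral_cong_AE)
    \<comment> \<open>If \<open>f\<close> already varies on \<open>{0..n}\<close>, the induction
      hypothesis applies at every \<open>s\<close>. Otherwise \<open>f (Suc n)\<close> is the first
      value to differ, and the event pins \<open>s\<close> to a single point.\<close>
    have "AE s in lborel. 0 < s \<longrightarrow> ?P s = 0"
    proof (cases "\<exists>i\<le>n. f i \<noteq> f 0")
      case True
      then obtain i where i: "i \<le> n" "f i \<noteq> f 0" by blast
      have "?P s = 0" if "0 < s" for s
      proof -
        have "{\<omega> \<in> space M. N s \<omega> = n \<and> occupation f s \<omega> + f (Suc n) * (t - s) \<in> {x}} =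
          {\<omega> \<in> space M. N s \<omega> = n \<and> occupation f s \<omega> = x - f (Suc n) * (t - s)}" by auto
        then show ?thesis
          by (simp only: Suc.IH[OF that i(1) le0 i(2)])
      qed
      then show ?thesis by simp
    next
      case False
      then have const: "f i = f 0" if "i \<le> n" for i using that by blast
      have ne: "f (Suc n) \<noteq> f 0"
      proof
        assume "f (Suc n) = f 0"
        then have "f i = f 0" if "i \<le> Suc n" for i
            using const that by (metis le_SucE)
          then show False using Suc.prems(2-4) by metis
      qed
      \<comment> \<open>The excluded point is the only solution of
        \<open>f 0 * s + f (Suc n) * (t - s) = x\<close>.\<close>
      have "AE s in lborel. s \<noteq> (x - f (Suc n) * t) / (f 0 - f (Suc n))"
        by (rule AE_lborel_singleton)
      then show ?thesis
      proof eventually_elim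
        case (elim s)
        show ?case
        proof
          assume s: "0 < s"
          have "{\<omega> \<in> space M. N s \<omega> = n \<and> occupation f s \<omega> + f (Suc n) * (t - s) \<in> {x}} = {}"
          proof (rule equals0I)
            fix \<omega> assume "\<omega> \<in> {\<omega> \<in> space M. N s \<omega> = n \<and> occupation f s \<omega> + f (Suc n) * (t - s) \<in> {x}}"
            then have \<omega>: "\<omega> \<in> space M" "N s \<omega> = n" "occupation f s \<omega> + f (Suc n) * (t - s) = x"
              by blast+
            have "occupation f s \<omega> = f 0 * s"
              by (rule occupation_const[OF \<omega>(1)]) (use s in simp, rule const, simp only: \<omega>(2))
            then have "s * (f 0 - f (Suc n)) = x - f (Suc n) * t"
              unfolding \<omega>(3)[symmetric] by (simp only: algebra_simps)
            then have "s = (x - f (Suc n) * t) / (f 0 - f (Suc n))"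
              using ne by (subst nonzero_eq_divide_eq) (simp only: right_minus_eq not_sym, assumption)
            then show False using elim by contradiction
          qed
          then show "?P s = 0" by (simp only: emeasure_empty)
        qed
      qed
    qed
    then show "AE s in lborel. indicator {0<..<t} s * ennreal (rate * exp (- rate * (t - s))) * ?P s = 0"
      by eventually_elim (auto split: split_indicator)
  qed
  finally show ?case by simp
qed

end

subsection \<open>The telegraph process\<close>

text \<open>An unnormalized beta density in \<open>u\<close>. The factor
  \<open>u ^ i / fact i\<close> is the convolution of \<open>i + 1\<close> indicators of the
  positive half-line, so it stands for \<open>i + 1\<close> sojourns of total length
  \<open>u\<close>; the other factor stands for \<open>j + 1\<close> sojourns filling the rest of
  \<open>s\<close>.\<close>

definition beta_kernel :: "nat \<Rightarrow> nat \<Rightarrow> real \<Rightarrow> real \<Rightarrow> real" where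
  "beta_kernel i j s u = u ^ i / fact i * ((s - u) ^ j / fact j)"

lemma beta_kernel_nonneg: "0 \<le> u \<Longrightarrow> u \<le> s \<Longrightarrow> 0 \<le> beta_kernel i j s u"
  by (simp add: beta_kernel_def)

lemma measurable_beta_kernel [measurable]:
  "f \<in> borel_measurable M \<Longrightarrow> g \<in> borel_measurable M \<Longrightarrow>
    (\<lambda>x. beta_kernel i j (f x) (g x)) \<in> borel_measurable M"
  unfolding beta_kernel_def
  by (intro borel_measurable_times borel_measurable_divide borel_measurable_power
      borel_measurable_diff borel_measurable_const)

lemma ennreal_beta_kernel:
  "0 \<le> u \<Longrightarrow> ennreal (beta_kernel i j s u) = ennreal (u ^ i / fact i) * ennreal ((s - u) ^ j / fact j)"
  unfolding beta_kernel_def by (rule ennreal_mult') simp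

lemma nn_integral_power_diff:
  fixes u t :: real
  assumes "u < t"
  shows "(\<integral>\<^sup>+s. indicator {u<..<t} s * ennreal ((s - u) ^ j / fact j) \<partial>lborel) =
    ennreal ((t - u) ^ Suc j / fact (Suc j))"
proof -
  have "(\<integral>\<^sup>+s. indicator {u<..<t} s * ennreal ((s - u) ^ j / fact j) \<partial>lborel) =
    (\<integral>\<^sup>+s. ennreal ((s - u) ^ j / fact j) * indicator {u..t} s \<partial>lborel)"
  proof (rule nn_integral_cong_AE)
    show "AE s in lborel. indicator {u<..<t} s * ennreal ((s - u) ^ j / fact j) =
        ennreal ((s - u) ^ j / fact j) * indicator {u..t} s"
      using AE_lborel_singleton[of u] AE_lborel_singleton[of t]
      by eventually_elim (use assms in \<open>auto split: split_indicator\<close>)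
  qed
  also have "\<dots> = ennreal ((t - u) ^ Suc j / fact (Suc j) - (u - u) ^ Suc j / fact (Suc j))"
  proof (rule nn_integral_FTC_Icc[where F = "\<lambda>s. (s - u) ^ Suc j / fact (Suc j)"])
    fix s assume s: "s \<in> {u..t}"
    have "((\<lambda>s. (s - u) ^ Suc j / fact (Suc j)) has_real_derivative
        (real (Suc j) * (s - u) ^ j) / fact (Suc j)) (at s)"
      by (auto intro!: derivative_eq_intros simp del: fact_Suc power_Suc)
    moreover have "(real (Suc j) * (s - u) ^ j) / fact (Suc j) = (s - u) ^ j / fact j"
      by (simp del: of_nat_Suc)
    ultimately show "((\<lambda>s. (s - u) ^ Suc j / fact (Suc j)) has_real_derivative (s - u) ^ j / fact j) (at s)"
      by (simp only:)
    show "0 \<le> (s - u) ^ j / fact j" using s by simp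
  qed (use assms in auto)
  finally show ?thesis by simp
qed

text \<open>One renewal step: after exchanging the integrals, \<open>s\<close> runs over
  \<open>{u<..<t}\<close> with \<open>u\<close> fixed, and only \<open>(s - u) ^ j / fact j\<close>
  depends on it. Its integral raises \<open>j\<close> by one, that is, adds a sojourn to the second
  group.\<close>

lemma nn_integral_beta_kernel:
  fixes g :: "real \<Rightarrow> ennreal"
  assumes [measurable]: "g \<in> borel_measurable borel"
  shows "(\<integral>\<^sup>+s. indicator {0<..<t} s *
      (\<integral>\<^sup>+u. indicator {0<..<s} u * ennreal (beta_kernel i j s u) * g u \<partial>lborel) \<partial>lborel) =
    (\<integral>\<^sup>+u. indicator {0<..<t} u * ennreal (beta_kernel i (Suc j) t u) * g u \<partial>lborel)"
proof -
  have "(\<integral>\<^sup>+s. indicator {0<..<t} s *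
      (\<integral>\<^sup>+u. indicator {0<..<s} u * ennreal (beta_kernel i j s u) * g u \<partial>lborel) \<partial>lborel) =
    (\<integral>\<^sup>+s. (\<integral>\<^sup>+u. (if 0 < u \<and> u < s \<and> s < t then ennreal (beta_kernel i j s u) * g u else 0) \<partial>lborel) \<partial>lborel)"
  proof (rule nn_integral_cong)
    fix s :: real
    have "indicator {0<..<t} s * (\<integral>\<^sup>+u. indicator {0<..<s} u * ennreal (beta_kernel i j s u) * g u \<partial>lborel) =
      (\<integral>\<^sup>+u. indicator {0<..<t} s * (indicator {0<..<s} u * ennreal (beta_kernel i j s u) * g u) \<partial>lborel)"
      by (rule nn_integral_cmult[symmetric]) measurable
    also have "\<dots> = (\<integral>\<^sup>+u. (if 0 < u \<and> u < s \<and> s < t then ennreal (beta_kernel i j s u) * g u else 0) \<partial>lborel)"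
      by (intro nn_integral_cong) (auto split: split_indicator)
    finally show "indicator {0<..<t} s * (\<integral>\<^sup>+u. indicator {0<..<s} u * ennreal (beta_kernel i j s u) * g u \<partial>lborel) =
      (\<integral>\<^sup>+u. (if 0 < u \<and> u < s \<and> s < t then ennreal (beta_kernel i j s u) * g u else 0) \<partial>lborel)" .
  qed
  also have "\<dots> = (\<integral>\<^sup>+u. (\<integral>\<^sup>+s. (if 0 < u \<and> u < s \<and> s < t then ennreal (beta_kernel i j s u) * g u else 0) \<partial>lborel) \<partial>lborel)"
    by (rule lborel_pair.Fubini') measurable
  also have "\<dots> = (\<integral>\<^sup>+u. indicator {0<..<t} u * ennreal (beta_kernel i (Suc j) t u) * g u \<partial>lborel)"
  proof (rule nn_integral_cong)
    fix u :: real
    show "(\<integral>\<^sup>+s. (if 0 < u \<and> u < s \<and> s < t then ennreal (beta_kernel i j s u) * g u else 0) \<partial>lborel) =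
      indicator {0<..<t} u * ennreal (beta_kernel i (Suc j) t u) * g u"
    proof (cases "u \<in> {0<..<t}")
      case True
      have "(\<integral>\<^sup>+s. (if 0 < u \<and> u < s \<and> s < t then ennreal (beta_kernel i j s u) * g u else 0) \<partial>lborel) =
        (\<integral>\<^sup>+s. (ennreal (u ^ i / fact i) * g u) * (indicator {u<..<t} s * ennreal ((s - u) ^ j / fact j)) \<partial>lborel)"
        using True by (intro nn_integral_cong)
          (auto split: split_indicator simp: ennreal_beta_kernel mult_ac)
      also have "\<dots> = (ennreal (u ^ i / fact i) * g u) * ennreal ((t - u) ^ Suc j / fact (Suc j))"
        using True by (subst nn_integral_cmult) (auto simp: nn_integral_power_diff simp del: fact_Suc power_Suc)
      also have "\<dots> = indicator {0<..<t} u * ennreal (beta_kernel i (Suc j) t u) * g u"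
        using True by (simp add: ennreal_beta_kernel mult_ac del: fact_Suc power_Suc)
      finally show ?thesis .
    next
      case False
      have "(\<integral>\<^sup>+s. (if 0 < u \<and> u < s \<and> s < t then ennreal (beta_kernel i j s u) * g u else 0) \<partial>lborel) =
        (\<integral>\<^sup>+(s::real). 0 \<partial>lborel)"
        using False by (intro nn_integral_cong) auto
      then show ?thesis using False by simp
    qed
  qed
  finally show ?thesis .
qed

lemma nn_integral_reflect:
  fixes g :: "real \<Rightarrow> ennreal"
  assumes "g \<in> borel_measurable borel"
  shows "(\<integral>\<^sup>+u. g u \<partial>lborel) = (\<integral>\<^sup>+u. g (s - u) \<partial>lborel)"
  using nn_integral_real_affine[OF assms, of "-1" s] by simp

context poisson_process
begin

text \<open>The time spent on the even states before time \<open>t\<close> has, on \<open>N t = Suc n\<close>, this density at \<open>u\<close>: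
  there are \<open>Suc n div 2 + 1\<close> sojourns in even and \<open>n div 2 + 1\<close> sojourns in odd states.\<close>

lemma alternating_occupation_law:
  assumes rt: "0 < rate" and t: "0 < t" and B: "B \<in> sets borel"
  shows "emeasure M {\<omega> \<in> space M. N t \<omega> = Suc n \<and> occupation (\<lambda>k. (- 1) ^ k) t \<omega> \<in> B} =
    ennreal (rate ^ Suc n * exp (- rate * t)) *
    (\<integral>\<^sup>+u. indicator {0<..<t} u * ennreal (beta_kernel (Suc n div 2) (n div 2) t u) * indicator B (2 * u - t) \<partial>lborel)"
  using t B
proof (induction n arbitrary: t B)
  case 0
  note t = \<open>0 < t\<close> and [measurable] = \<open>B \<in> sets borel\<close>
  have "emeasure M {\<omega> \<in> space M. N t \<omega> = Suc 0 \<and> occupation (\<lambda>k. (- 1) ^ k) t \<omega> \<in> B} =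
    (\<integral>\<^sup>+s. indicator {0<..<t} s * ennreal (rate * exp (- rate * (t - s))) *
      emeasure M {\<omega> \<in> space M. N s \<omega> = 0 \<and> occupation (\<lambda>k. (- 1) ^ k) s \<omega> + (- 1) ^ Suc 0 * (t - s) \<in> B} \<partial>lborel)"
    by (rule occupation_renewal[OF rt t]) measurable
  also have "\<dots> = (\<integral>\<^sup>+s. ennreal (rate * exp (- rate * t)) * (indicator {0<..<t} s * indicator B (2 * s - t)) \<partial>lborel)"
  proof (rule nn_integral_cong)
    fix s :: real
    show "indicator {0<..<t} s * ennreal (rate * exp (- rate * (t - s))) *
      emeasure M {\<omega> \<in> space M. N s \<omega> = 0 \<and> occupation (\<lambda>k. (- 1) ^ k) s \<omega> + (- 1) ^ Suc 0 * (t - s) \<in> B} =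
      ennreal (rate * exp (- rate * t)) * (indicator {0<..<t} s * indicator B (2 * s - t))"
    proof (cases "s \<in> {0<..<t}")
      case True
      then have s: "0 < s" by simp
      have "prob {\<omega> \<in> space M. N s \<omega> - N 0 \<omega> \<in> {0}} = exp (- rate * s)"
        using s rt by (subst prob_increment) (auto simp: measure_pmf_single)
      moreover have "{\<omega> \<in> space M. N s \<omega> - N 0 \<omega> \<in> {0}} = {\<omega> \<in> space M. N s \<omega> = 0}"
        using count_zero by auto
      ultimately have p: "emeasure M {\<omega> \<in> space M. N s \<omega> = 0} = ennreal (exp (- rate * s))"
        by (simp only: emeasure_eq_measure)
      \<comment> \<open>With a single jump at \<open>s\<close>, the even state lasts
        \<open>s\<close> and the odd one \<open>t - s\<close>; accordingly
        \<open>beta_kernel 0 0\<close> is constantly \<open>1\<close>.\<close>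
      have occ: "occupation (\<lambda>k. (- 1) ^ k) s \<omega> + (- 1) ^ Suc 0 * (t - s) = 2 * s - t"
        if "\<omega> \<in> space M" "N s \<omega> = 0" for \<omega>
        using occupation_const[OF that(1), of s "\<lambda>k. (- 1) ^ k" 1] that(2) s by simp
      then have "{\<omega> \<in> space M. N s \<omega> = 0 \<and> occupation (\<lambda>k. (- 1) ^ k) s \<omega> + (- 1) ^ Suc 0 * (t - s) \<in> B} =
        (if 2 * s - t \<in> B then {\<omega> \<in> space M. N s \<omega> = 0} else {})"
        by (auto simp del: power_Suc)
      moreover have "ennreal (rate * exp (- rate * (t - s))) * ennreal (exp (- rate * s)) = ennreal (rate * exp (- rate * t))"
        using rt by (simp add: ennreal_mult'[symmetric] exp_add[symmetric] algebra_simps)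
      ultimately show ?thesis using True p by (simp add: mult_ac)
    qed simp
  qed
  also have "\<dots> = ennreal (rate * exp (- rate * t)) * (\<integral>\<^sup>+s. indicator {0<..<t} s * indicator B (2 * s - t) \<partial>lborel)"
    by (rule nn_integral_cmult) measurable
  finally show ?case by (simp add: beta_kernel_def)
next
  case (Suc n)
  note t = \<open>0 < t\<close> and B[measurable] = \<open>B \<in> sets borel\<close>
  let ?f = "\<lambda>k. (- 1) ^ k :: real"
  let ?c = "\<lambda>s. ?f (Suc (Suc n)) * (t - s)"
  let ?I = "\<lambda>s. \<integral>\<^sup>+u. indicator {0<..<s} u * ennreal (beta_kernel (Suc n div 2) (n div 2) s u) * indicator B (2 * u - s + ?c s) \<partial>lborel"
  have "emeasure M {\<omega> \<in> space M. N t \<omega> = Suc (Suc n) \<and> occupation ?f t \<omega> \<in> B} =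
    (\<integral>\<^sup>+s. indicator {0<..<t} s * ennreal (rate * exp (- rate * (t - s))) *
      emeasure M {\<omega> \<in> space M. N s \<omega> = Suc n \<and> occupation ?f s \<omega> + ?c s \<in> B} \<partial>lborel)"
    by (rule occupation_renewal[OF rt t B])
  also have "\<dots> = (\<integral>\<^sup>+s. ennreal (rate ^ Suc (Suc n) * exp (- rate * t)) * (indicator {0<..<t} s * ?I s) \<partial>lborel)"
  proof (rule nn_integral_cong)
    fix s :: real
    show "indicator {0<..<t} s * ennreal (rate * exp (- rate * (t - s))) *
      emeasure M {\<omega> \<in> space M. N s \<omega> = Suc n \<and> occupation ?f s \<omega> + ?c s \<in> B} =
      ennreal (rate ^ Suc (Suc n) * exp (- rate * t)) * (indicator {0<..<t} s * ?I s)"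
    proof (cases "s \<in> {0<..<t}")
      case True
      then have s: "0 < s" by simp
      \<comment> \<open>The induction hypothesis is applied to \<open>B\<close> shifted by the
        contribution of the final sojourn.\<close>
      have B': "(\<lambda>y. y + ?c s) -` B \<in> sets borel"
        using measurable_sets[of "\<lambda>y. y + ?c s" borel borel B] B by simp
      have "emeasure M {\<omega> \<in> space M. N s \<omega> = Suc n \<and> occupation ?f s \<omega> + ?c s \<in> B} =
         ennreal (rate ^ Suc n * exp (- rate * s)) * ?I s"
        using Suc.IH[OF s B'] by (simp only: vimage_eq indicator_vimage)
      moreover have "ennreal (rate * exp (- rate * (t - s))) * ennreal (rate ^ Suc n * exp (- rate * s)) =
          ennreal (rate ^ Suc (Suc n) * exp (- rate * t))"
      proof -
        have "exp (- rate * (t - s)) * exp (- rate * s) = exp (- rate * t)"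
          by (simp add: exp_add[symmetric] algebra_simps)
        then have "(rate * exp (- rate * (t - s))) * (rate ^ Suc n * exp (- rate * s)) = rate ^ Suc (Suc n) * exp (- rate * t)"
          by (simp add: mult_ac)
        then show ?thesis using rt by (subst ennreal_mult'[symmetric]) (simp_all only: mult_nonneg_nonneg less_imp_le exp_ge_zero zero_le_power)
      qed
      ultimately show ?thesis using True by (simp only: indicator_simps if_True mult_1 mult.assoc[symmetric])
    qed simp
  qed
  also have "\<dots> = ennreal (rate ^ Suc (Suc n) * exp (- rate * t)) * (\<integral>\<^sup>+s. indicator {0<..<t} s * ?I s \<partial>lborel)"
  proof (rule nn_integral_cmult)
    have "?I s = (\<integral>\<^sup>+u. (if 0 < u \<and> u < s then ennreal (beta_kernel (Suc n div 2) (n div 2) s u) * indicator B (2 * u - s + ?c s) else 0) \<partial>lborel)" for s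
      by (intro nn_integral_cong) (auto split: split_indicator)
    then show "(\<lambda>s. indicator {0<..<t} s * ?I s) \<in> borel_measurable lborel"
      by (simp only:) measurable
  qed
  \<comment> \<open>For even \<open>n\<close> the new state is even, so the first exponent has to
    grow, whereas \<open>nn_integral_beta_kernel\<close> raises the second; reflecting
    \<open>u\<close> to \<open>s - u\<close> before and to \<open>t - u\<close> after that step
    exchanges the two. For odd \<open>n\<close> it applies directly.\<close>
  also have "(\<integral>\<^sup>+s. indicator {0<..<t} s * ?I s \<partial>lborel) =
    (\<integral>\<^sup>+u. indicator {0<..<t} u * ennreal (beta_kernel (Suc (Suc n) div 2) (Suc n div 2) t u) * indicator B (2 * u - t) \<partial>lborel)"
  proof (cases "even n")
    case True
    have "?I s = (\<integral>\<^sup>+w. indicator {0<..<s} w * ennreal (beta_kernel (n div 2) (n div 2) s w) * indicator B (t - 2 * w) \<partial>lborel)" for s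
      using True by (subst nn_integral_reflect[of _ s])
        (measurable, auto intro!: nn_integral_cong split: split_indicator simp: beta_kernel_def mult_ac algebra_simps)
    then have "(\<integral>\<^sup>+s. indicator {0<..<t} s * ?I s \<partial>lborel) =
      (\<integral>\<^sup>+w. indicator {0<..<t} w * ennreal (beta_kernel (n div 2) (Suc (n div 2)) t w) * indicator B (t - 2 * w) \<partial>lborel)"
      by (simp only:) (rule nn_integral_beta_kernel, measurable)
    also have "\<dots> = (\<integral>\<^sup>+u. indicator {0<..<t} u * ennreal (beta_kernel (Suc (n div 2)) (n div 2) t u) * indicator B (2 * u - t) \<partial>lborel)"
      by (subst nn_integral_reflect[of _ t])
        (measurable, auto intro!: nn_integral_cong split: split_indicator simp: beta_kernel_def mult_ac algebra_simps)
    finally show ?thesis using True by simp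
  next
    case False
    then have n: "Suc n div 2 = Suc (n div 2)" by simp
    have "2 * u - s + ?c s = 2 * u - t" for u s using False by simp
    then have "(\<integral>\<^sup>+s. indicator {0<..<t} s * ?I s \<partial>lborel) =
      (\<integral>\<^sup>+u. indicator {0<..<t} u * ennreal (beta_kernel (Suc n div 2) (Suc (n div 2)) t u) * indicator B (2 * u - t) \<partial>lborel)"
      by (simp only:) (rule nn_integral_beta_kernel, measurable)
    then show ?thesis using False by simp
  qed
  finally show ?case .
qed

end

subsection \<open>The Bessel series\<close>

text \<open>The function \<open>bessel_I0\<close> at \<open>z\<close>, in the variable
  \<open>z\<^sup>2 / 4\<close>. The series is entire and free of the square root, so the time
  derivative needs only the chain rule with a quadratic polynomial.\<close>

definition bessel_series :: "real \<Rightarrow> real" where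
  "bessel_series y = (\<Sum>k. inverse ((fact k)\<^sup>2) * y ^ k)"

lemma summable_bessel: "summable (\<lambda>k. inverse ((fact k)\<^sup>2) * y ^ k :: real)"
proof (rule summable_comparison_test')
  show "summable (\<lambda>k. inverse (fact k) * \<bar>y\<bar> ^ k :: real)" by (rule summable_exp)
  fix k :: nat
  have "(1::real) \<le> fact k" by (rule fact_ge_1)
  then have "inverse ((fact k)\<^sup>2) \<le> (inverse (fact k) :: real)"
    by (intro le_imp_inverse_le) (simp_all add: power2_eq_square)
  then show "norm (inverse ((fact k)\<^sup>2) * y ^ k) \<le> inverse (fact k) * \<bar>y\<bar> ^ k"
    by (simp add: abs_mult power_abs mult_right_mono)
qed

lemma diffs_bessel: "diffs (\<lambda>k. inverse ((fact k)\<^sup>2) :: real) k = inverse (fact (Suc k) * fact k)"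
proof -
  define a b :: real where "a = real (Suc k)" and "b = fact k"
  have "a \<noteq> 0" "b \<noteq> 0" by (simp_all add: a_def b_def)
  then have "a * inverse ((a * b)\<^sup>2) = inverse (a * b * b)" by (simp add: power2_eq_square field_simps)
  then show ?thesis unfolding diffs_def a_def b_def by (simp only: fact_Suc)
qed

lemma bessel_series_sums: "(\<lambda>k. inverse ((fact k)\<^sup>2) * y ^ k) sums bessel_series y"
  unfolding bessel_series_def by (rule summable_sums[OF summable_bessel])

text \<open>Termwise differentiation; the resulting coefficients are those of the modified Bessel
  function of order 1.\<close>

lemma bessel_series_deriv:
  "(bessel_series has_real_derivative (\<Sum>k. inverse (fact (Suc k) * fact k) * y ^ k)) (at y)"
  using termdiffs_strong_converges_everywhere[OF summable_bessel, of y]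
  unfolding diffs_bessel bessel_series_def[abs_def] .

lemma summable_bessel_deriv: "summable (\<lambda>k. inverse (fact (Suc k) * fact k) * y ^ k :: real)"
  using termdiff_converges_all[OF summable_bessel, of y] unfolding diffs_bessel .

lemma bessel_I0_sqrt: "0 \<le> y \<Longrightarrow> bessel_I0 (a * sqrt y) = bessel_series (a\<^sup>2 * y / 4)"
proof -
  assume "0 \<le> y"
  then have "(a * sqrt y / 2)\<^sup>2 = a\<^sup>2 * y / 4" by (simp add: power_mult_distrib power_divide)
  then show ?thesis
    unfolding bessel_I0_def bessel_series_def power_mult by (simp only: divide_inverse mult.commute)
qed

text \<open>The term \<open>n\<close> belongs to \<open>Suc n\<close> events. For even \<open>n\<close> the terms form the series of \<open>I\<^sub>0\<close>, for odd
  \<open>n\<close> that of its derivative; the factor \<open>t\<close> of the latter arises as \<open>u + v\<close>.\<close>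

lemma axis_density_sums:
  fixes rate c p q t x :: real
  assumes c: "0 < c" and x: "\<bar>x\<bar> < c * t"
  defines "r \<equiv> 1 - p - q" and "u \<equiv> t / 2 + x / (2 * c)" and "v \<equiv> t / 2 - x / (2 * c)"
  shows "(\<lambda>n. rate ^ Suc n * exp (- rate * t) * r ^ Suc n *
      (beta_kernel (Suc n div 2) (n div 2) t u + beta_kernel (Suc n div 2) (n div 2) t v) / (8 * c))
    sums axis_density rate c p q x t"
proof -
  \<comment> \<open>\<open>u\<close> and \<open>v\<close> are the times spent moving right and left
    on the way to \<open>x\<close>: they add up to \<open>t\<close>, and
    \<open>c * (u - v) = x\<close>. The quantity \<open>w\<close> is a quarter of the squared Bessel
    argument.\<close>
  define w where "w = (rate * r)\<^sup>2 * (u * v)"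
  have tu: "t - u = v" "t - v = u" by (simp_all add: u_def v_def field_simps)
  have uv: "u * v = (t\<^sup>2 - (x / c)\<^sup>2) / 4"
  proof -
    have eqs: "u = (t + x / c) / 2" "v = (t - x / c) / 2" by (simp_all add: u_def v_def field_simps)
    have "(a + b) / 2 * ((a - b) / 2) = (a\<^sup>2 - b\<^sup>2) / 4" for a b :: real
      by (simp add: power2_eq_square square_diff_square_factored mult.commute)
    then show ?thesis unfolding eqs .
  qed
  have ct: "c\<^sup>2 * t\<^sup>2 = (c * t)\<^sup>2" by (simp add: power_mult_distrib)
  have pos: "0 < c\<^sup>2 * t\<^sup>2 - x\<^sup>2"
    unfolding ct using x power_strict_mono[of "\<bar>x\<bar>" "c * t" 2] by simp
  define h where "h s = (rate * r)\<^sup>2 * (s\<^sup>2 - (x / c)\<^sup>2) / 4" for s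
  have ht: "h t = w" by (simp add: h_def w_def uv)
  have hs: "(rate / c * r)\<^sup>2 * (c\<^sup>2 * s\<^sup>2 - x\<^sup>2) / 4 = h s" for s
  proof -
    have 1: "(rate / c * r)\<^sup>2 = (rate * r)\<^sup>2 / c\<^sup>2" by (simp add: power_mult_distrib power_divide)
    have 2: "(c\<^sup>2 * s\<^sup>2 - x\<^sup>2) / c\<^sup>2 = s\<^sup>2 - (x / c)\<^sup>2"
      using c by (simp add: power_divide diff_divide_distrib)
    show ?thesis unfolding h_def 1 2[symmetric] by (simp only: times_divide_eq_left times_divide_eq_right)
  qed
  have I0: "bessel_I0 (rate / c * r * sqrt (c\<^sup>2 * t\<^sup>2 - x\<^sup>2)) = bessel_series w"
    unfolding bessel_I0_sqrt[OF less_imp_le[OF pos]] hs ht ..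
  let ?D = "\<Sum>k. inverse (fact (Suc k) * fact k) * w ^ k"
  have der: "((\<lambda>s. bessel_series (h s)) has_real_derivative ?D * ((rate * r)\<^sup>2 * t / 2)) (at t)"
  proof (rule DERIV_chain2[where f = bessel_series])
    show "(bessel_series has_real_derivative ?D) (at (h t))"
      using bessel_series_deriv[of w] ht by simp
    show "(h has_real_derivative (rate * r)\<^sup>2 * t / 2) (at t)"
      unfolding h_def by (auto intro!: derivative_eq_intros)
  qed
  \<comment> \<open>\<open>bessel_I0_sqrt\<close> needs a nonnegative radicand. It is positive at
    \<open>t\<close>, hence near \<open>t\<close>, and the derivative asks for no more.\<close>
  have ev: "\<forall>\<^sub>F s in nhds t. bessel_series (h s) = bessel_I0 (rate / c * r * sqrt (c\<^sup>2 * s\<^sup>2 - x\<^sup>2))"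
  proof -
    have "((\<lambda>s. c\<^sup>2 * s\<^sup>2 - x\<^sup>2) \<longlongrightarrow> c\<^sup>2 * t\<^sup>2 - x\<^sup>2) (nhds t)"
      by (intro tendsto_intros) (simp add: filterlim_ident)
    from order_tendstoD(1)[OF this pos] show ?thesis
    proof eventually_elim
      case (elim s)
      show ?case unfolding bessel_I0_sqrt[OF less_imp_le[OF elim]] hs ..
    qed
  qed
  have "((\<lambda>s. bessel_I0 (rate / c * r * sqrt (c\<^sup>2 * s\<^sup>2 - x\<^sup>2)))
      has_real_derivative ?D * ((rate * r)\<^sup>2 * t / 2)) (at t)"
    by (rule DERIV_cong_ev[OF refl ev refl, THEN iffD1, OF der])
  then have deriv: "deriv (\<lambda>s. bessel_I0 (rate / c * r * sqrt (c\<^sup>2 * s\<^sup>2 - x\<^sup>2))) t = ?D * ((rate * r)\<^sup>2 * t / 2)"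
    by (rule DERIV_imp_deriv)
  let ?e = "exp (- rate * t) / (4 * c)"
  have 1: "(\<lambda>k. ?e * (rate * r) * (inverse ((fact k)\<^sup>2) * w ^ k)) sums (?e * (rate * r) * bessel_series w)"
    by (rule sums_mult[OF bessel_series_sums])
  have 2: "(\<lambda>k. ?e * ((rate * r)\<^sup>2 * t / 2) * (inverse (fact (Suc k) * fact k) * w ^ k)) sums
      (?e * ((rate * r)\<^sup>2 * t / 2) * ?D)"
    by (rule sums_mult[OF summable_sums[OF summable_bessel_deriv]])
  have axis: "axis_density rate c p q x t = ?e * (rate * r) * bessel_series w + ?e * ((rate * r)\<^sup>2 * t / 2) * ?D"
    unfolding axis_density_def r_def[symmetric] I0 deriv by (simp only: distrib_left mult_ac)
  have terms: "rate ^ Suc n * exp (- rate * t) * r ^ Suc n *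
      (beta_kernel (Suc n div 2) (n div 2) t u + beta_kernel (Suc n div 2) (n div 2) t v) / (8 * c) =
    (if even n then ?e * (rate * r) * (inverse ((fact (n div 2))\<^sup>2) * w ^ (n div 2))
     else ?e * ((rate * r)\<^sup>2 * t / 2) * (inverse (fact (Suc ((n - 1) div 2)) * fact ((n - 1) div 2)) * w ^ ((n - 1) div 2)))" for n
  proof (cases "even n")
    case True
    then obtain k where k: "n = 2 * k" by (elim evenE)
    \<comment> \<open>With equal exponents the kernel is symmetric in \<open>u\<close> and
      \<open>v\<close>, hence the factor \<open>2\<close>.\<close>
    have "a / b * (d / b) + d / b * (a / b) = 2 * (inverse (b\<^sup>2) * (a * d))" for a b d :: real
      by (simp add: field_simps power2_eq_square)
    then have beta: "beta_kernel k k t u + beta_kernel k k t v = 2 * (inverse ((fact k)\<^sup>2) * (u * v) ^ k)"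
      unfolding beta_kernel_def tu power_mult_distrib .
    have wk: "w ^ k * (rate * r) = rate ^ Suc n * r ^ Suc n * (u * v) ^ k"
      by (simp add: w_def k power_mult_distrib power_mult)
    have alg: "a * e * b * (2 * (g * y)) / (8 * c) = e / (4 * c) * m * (g * z)"
      if "z * m = a * b * y" for a b e g m y z
    proof -
      have "a * e * b * (2 * (g * y)) / (8 * c) = e / (4 * c) * g * (a * b * y)" by simp
      also have "\<dots> = e / (4 * c) * m * (g * z)" unfolding that[symmetric] by (simp only: mult_ac)
      finally show ?thesis .
    qed
    have div: "Suc n div 2 = k" "n div 2 = k" by (simp_all add: k)
    show ?thesis unfolding div beta if_P[OF True] by (rule alg[OF wk])
  next
    case False
    then obtain k where k: "n = 2 * k + 1" by (elim oddE)
    have uvt: "u + v = t" by (simp add: u_def v_def)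
    have "(u * a) / b * (d / e) + (v * d) / b * (a / e) = (a * d) * (u + v) * inverse (b * e)"
      for a b d e :: real
      by (simp add: divide_inverse algebra_simps)
    then have beta: "beta_kernel (Suc k) k t u + beta_kernel (Suc k) k t v =
        (u * v) ^ k * t * inverse (fact (Suc k) * fact k)"
      unfolding beta_kernel_def tu power_mult_distrib power_Suc uvt .
    have wk: "w ^ k * (rate * r)\<^sup>2 = rate ^ Suc n * r ^ Suc n * (u * v) ^ k"
      by (simp add: w_def k power_mult_distrib power_mult power2_eq_square)
    have alg: "a * e * b * (y * t * g) / (8 * c) = e / (4 * c) * (m * t / 2) * (g * z)"
      if "z * m = a * b * y" for a b e g m y z
    proof -
      have "a * e * b * (y * t * g) / (8 * c) = e / (4 * c) * g * t / 2 * (a * b * y)" by simp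
      also have "\<dots> = e / (4 * c) * (m * t / 2) * (g * z)" unfolding that[symmetric] by simp
      finally show ?thesis .
    qed
    have div: "Suc n div 2 = Suc k" "n div 2 = k" "(n - 1) div 2 = k" by (simp_all add: k)
    show ?thesis unfolding div beta if_not_P[OF False] by (rule alg[OF wk])
  qed
  show ?thesis unfolding terms axis by (subst add.commute) (rule sums_if[OF 2 1])
qed

section \<open>Vanishing occupation integrals and the four directions\<close>

context poisson_process
begin

text \<open>Measurability relative to any sigma-algebra that makes the counts measurable. It is
  needed for the one generated by the counts alone, to which the independence of the sources
  refers.\<close>

lemma occupation_in_sets:
  assumes K: "space K = space M" "\<And>u. 0 \<le> u \<Longrightarrow> N u \<in> measurable K (count_space UNIV)"
    and s: "0 \<le> s" and B: "B \<in> sets borel"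
  shows "{\<omega> \<in> space M. N s \<omega> = n \<and> occupation f s \<omega> \<in> B} \<in> sets K"
proof -
  have \<tau>: "\<tau> k s \<in> borel_measurable K" for k
    unfolding borel_measurable_iff_greater
  proof
    fix a
    show "{\<omega> \<in> space K. a < \<tau> k s \<omega>} \<in> sets K"
    proof (cases "0 \<le> a")
      case True
      have "{\<omega> \<in> space K. a < \<tau> k s \<omega>} = (if a < s then N a -` {..<k} \<inter> space K else {})"
        using less_\<tau>_iff[OF _ True] K(1) by auto
      then show ?thesis using measurable_sets[OF K(2)[OF True], of "{..<k}"] by auto
    next
      case False
      then have "{\<omega> \<in> space K. a < \<tau> k s \<omega>} = space K"
        using less_le_trans[OF _ \<tau>_nonneg, of a] by auto
      then show ?thesis by auto
    qed
  qed
  note [measurable] = \<tau> K(2)[OF s] B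
  have [measurable]: "occupation f s \<in> borel_measurable K"
  proof -
    have "(\<lambda>\<omega>. \<Sum>k\<le>N s \<omega>. f k * (\<tau> (Suc k) s \<omega> - \<tau> k s \<omega>)) \<in> borel_measurable K"
      by (rule measurable_compose_countable[OF _ K(2)[OF s]]) measurable
    then show ?thesis unfolding occupation_def[abs_def] .
  qed
  have "{\<omega> \<in> space K. N s \<omega> = n \<and> occupation f s \<omega> \<in> B} \<in> sets K" by measurable
  then show ?thesis by (simp only: K(1))
qed

lemma occupation_cong:
  "(\<And>k. k \<le> N s \<omega> \<Longrightarrow> f k = g k) \<Longrightarrow> occupation f s \<omega> = occupation g s \<omega>"
  unfolding occupation_def by (intro sum.cong) auto

text \<open>The quantifier over the uncountably many \<open>g\<close> stands inside the almost sure
  statement, so that \<open>g\<close> may later be the random path of direction indices. One null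
  set suffices since only finitely many integer values of \<open>g\<close> enter, and there are
  countably many integer lists.\<close>

lemma AE_occupation_eq_0:
  fixes f :: "int \<Rightarrow> real"
  assumes rt: "0 < rate" and t: "0 < t"
  shows "AE \<omega> in M. \<forall>g. occupation (\<lambda>k. f (g k)) t \<omega> = 0 \<longrightarrow> (\<forall>k\<le>N t \<omega>. f (g k) = 0)"
proof -
  have "AE \<omega> in M. \<forall>n. \<forall>L. (\<exists>j\<le>n. \<exists>k\<le>n. f (L ! j) \<noteq> f (L ! k)) \<longrightarrow>
      \<not> (N t \<omega> = n \<and> occupation (\<lambda>k. f (L ! k)) t \<omega> = 0)"
  proof (unfold AE_all_countable, intro allI)
    fix n and L :: "int list"
    show "AE \<omega> in M. (\<exists>j\<le>n. \<exists>k\<le>n. f (L ! j) \<noteq> f (L ! k)) \<longrightarrow>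
      \<not> (N t \<omega> = n \<and> occupation (\<lambda>k. f (L ! k)) t \<omega> = 0)"
    proof (cases "\<exists>j\<le>n. \<exists>k\<le>n. f (L ! j) \<noteq> f (L ! k)")
      case True
      then obtain j k where "j \<le> n" "k \<le> n" "f (L ! j) \<noteq> f (L ! k)" by blast
      from occupation_no_atom[OF rt t, of j n k "\<lambda>k. f (L ! k)" 0, OF this]
      have "{\<omega> \<in> space M. N t \<omega> = n \<and> occupation (\<lambda>k. f (L ! k)) t \<omega> = 0} \<in> null_sets M"
        using count_eq_occupation_in_events[of t "{0}" n "\<lambda>k. f (L ! k)" 0] t
        by (intro null_setsI) auto
      from AE_not_in[OF this] AE_space show ?thesis by eventually_elim blast
    next
      case False
      then show ?thesis by (intro AE_I2 impI) (rule notE)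
    qed
  qed
  with AE_space show ?thesis
  proof eventually_elim
    case (elim \<omega>)
    show ?case
    proof (intro allI impI)
      fix g k assume occ: "occupation (\<lambda>k. f (g k)) t \<omega> = 0" and k: "k \<le> N t \<omega>"
      \<comment> \<open>The values of \<open>g\<close> up to \<open>N t \<omega>\<close> are all
        that the occupation integral sees.\<close>
      define L where "L = map g [0..<Suc (N t \<omega>)]"
      have L: "L ! j = g j" if "j \<le> N t \<omega>" for j
        using that by (simp add: L_def del: upt_Suc)
      have occL: "occupation (\<lambda>k. f (L ! k)) t \<omega> = 0"
        using occupation_cong[of t \<omega> "\<lambda>k. f (L ! k)" "\<lambda>k. f (g k)"] L occ by simp
      have const: "f (g j) = f (g 0)" if "j \<le> N t \<omega>" for j
      proof (rule ccontr)
        assume "f (g j) \<noteq> f (g 0)"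
        then have "f (L ! j) \<noteq> f (L ! 0)" using L that by simp
        then show False using elim occL that by blast
      qed
      have "occupation (\<lambda>k. f (g k)) t \<omega> = f (g 0) * t"
        by (rule occupation_const) (use elim t const in \<open>blast intro: less_imp_le\<close>)+
      then show "f (g k) = 0" using occ t const[OF k] by simp
    qed
  qed
qed

end

lemma sin_pi_half_int_eq_0_iff: "sin (pi * of_int m / 2) = 0 \<longleftrightarrow> even m"
proof
  assume "sin (pi * of_int m / 2) = 0"
  then obtain i :: int where "pi * of_int m / 2 = of_int i * pi" unfolding sin_zero_iff_int2 by blast
  then have "real_of_int m = of_int (2 * i)" by (simp add: field_simps)
  then have "m = 2 * i" by (simp only: of_int_eq_iff)
  then show "even m" by simp
next
  assume "even m"
  then obtain i where "m = 2 * i" by (elim evenE)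
  then have "pi * of_int m / 2 = of_int i * pi" by simp
  then show "sin (pi * of_int m / 2) = 0" unfolding sin_zero_iff_int2 by blast
qed

lemma cos_pi_half_even: "cos (pi * of_int (2 * int k) / 2) = (- 1) ^ k"
  using cos_npi[of k] by (simp add: mult.commute)

lemma cos_pi_half_even_shift: "cos (pi * of_int (2 + 2 * int k) / 2) = - ((- 1) ^ k)"
proof -
  have "pi * of_int (2 + 2 * int k) / 2 = real k * pi + pi" by (simp add: field_simps)
  then show ?thesis by (simp only: cos_periodic_pi cos_npi)
qed

section \<open>The initial direction, the turns and the independence of the sources\<close>

context planar_motion
begin

abbreviation index :: "'a \<Rightarrow> nat \<Rightarrow> int" where
  "index \<omega> k \<equiv> start \<omega> + (\<Sum>j<k. turn j \<omega>)"

lemma position_eq: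
  assumes "\<omega> \<in> space M" "0 \<le> t"
  shows "fst (position c N start turn t \<omega>) = c * occupation (\<lambda>k. cos (pi * of_int (index \<omega> k) / 2)) t \<omega>"
    and "snd (position c N start turn t \<omega>) = c * occupation (\<lambda>k. sin (pi * of_int (index \<omega> k) / 2)) t \<omega>"
  using integral_count[OF assms, of "\<lambda>k. dir (index \<omega> k)"]
  by (simp_all add: position_def direction_def occupation_def dir_def fst_sum snd_sum mult.commute)

lemma measurable_index [measurable]: "(\<lambda>\<omega>. index \<omega> k) \<in> measurable M (count_space UNIV)"
proof (induction k)
  case 0
  then show ?case using start_measurable by simp
next
  case (Suc k)
  note [measurable] = Suc turn_measurable
  have "(\<lambda>\<omega>. index \<omega> k + turn k \<omega>) \<in> measurable M (count_space UNIV)" by measurable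
  then show ?case by (simp add: add.assoc)
qed

lemma measurable_occupation_index:
  assumes "0 \<le> t"
  shows "(\<lambda>\<omega>. occupation (\<lambda>k. f (index \<omega> k)) t \<omega>) \<in> borel_measurable M"
proof -
  have [measurable]: "(\<lambda>\<omega>. f (index \<omega> k)) \<in> borel_measurable M" for k
    by (rule measurable_compose[OF measurable_index]) simp
  show ?thesis unfolding occupation_def
    by (rule measurable_compose_countable[OF _ count_measurable[OF assms]]) measurable
qed

lemma AE_start: "AE \<omega> in M. start \<omega> \<in> {0, 1, 2, 3}"
proof -
  have "AE x in distr M (count_space UNIV) start. x \<in> {0, 1, 2, 3}"
    unfolding start_uniform by (simp add: AE_measure_pmf_iff)
  from AE_distrD[OF start_measurable this] show ?thesis .
qed

text \<open>The three prescribed point masses add up to \<open>1\<close>.\<close>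

lemma AE_turn: "AE \<omega> in M. turn k \<omega> \<in> {1, - 1, 2}"
proof -
  note [measurable] = turn_measurable
  have "prob {\<omega> \<in> space M. turn k \<omega> \<in> {1, - 1, 2}} =
     prob ({\<omega> \<in> space M. turn k \<omega> = 1} \<union> {\<omega> \<in> space M. turn k \<omega> = - 1} \<union> {\<omega> \<in> space M. turn k \<omega> = 2})"
    by (intro arg_cong[where f = prob]) auto
  also have "\<dots> = prob ({\<omega> \<in> space M. turn k \<omega> = 1} \<union> {\<omega> \<in> space M. turn k \<omega> = - 1}) + prob {\<omega> \<in> space M. turn k \<omega> = 2}"
    by (rule finite_measure_Union) auto
  also have "prob ({\<omega> \<in> space M. turn k \<omega> = 1} \<union> {\<omega> \<in> space M. turn k \<omega> = - 1}) =
      prob {\<omega> \<in> space M. turn k \<omega> = 1} + prob {\<omega> \<in> space M. turn k \<omega> = - 1}"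
    by (rule finite_measure_Union) auto
  finally have "prob {\<omega> \<in> space M. turn k \<omega> \<in> {1, - 1, 2}} = 1"
    by (simp add: turn_counterclockwise turn_clockwise turn_reflection)
  from AE_prob_1[OF this] show ?thesis by eventually_elim blast
qed

lemma prob_start:
  assumes "j \<in> {0, 1, 2, 3}"
  shows "prob {\<omega> \<in> space M. start \<omega> = j} = 1 / 4"
proof -
  have "prob (start -` {j} \<inter> space M) = measure (pmf_of_set {0, 1, 2, 3}) {j}"
    using measure_distr[OF start_measurable, of "{j}"] by (simp add: start_uniform)
  also have "\<dots> = 1 / 4" using assms by (auto simp: measure_pmf_single)
  also have "start -` {j} \<inter> space M = {\<omega> \<in> space M. start \<omega> = j}" by auto
  finally show ?thesis .
qed

text \<open>The event is an intersection with one factor per source, over the finitely many sources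
  that it mentions: \<open>1 / 4\<close> comes from the start and \<open>1 - p - q\<close> from each
  turn.\<close>

lemma prob_reflections:
  assumes t: "0 \<le> t" and B: "B \<in> sets borel" and j: "j \<in> {0, 1, 2, 3}"
  shows "prob {\<omega> \<in> space M. (N t \<omega> = n \<and> occupation f t \<omega> \<in> B) \<and> start \<omega> = j \<and> (\<forall>k<n. turn k \<omega> = 2)} =
    prob {\<omega> \<in> space M. N t \<omega> = n \<and> occupation f t \<omega> \<in> B} * ((1 - p - q) ^ n / 4)"
proof -
  let ?C = "{\<omega> \<in> space M. N t \<omega> = n \<and> occupation f t \<omega> \<in> B}"
  let ?G = "{N t -` A \<inter> space M |t A. 0 \<le> t}"
  let ?K = "sigma (space M) ?G"
  have G: "?G \<subseteq> Pow (space M)" by auto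
  \<comment> \<open>Independence asks for the occupation event to lie in the sigma-algebra generated
    by the counts, not merely in \<open>events\<close>.\<close>
  have K: "N u \<in> measurable ?K (count_space UNIV)" if "0 \<le> u" for u
    using that G by (auto simp: measurable_def space_measure_of_conv sets_measure_of intro!: sigma_sets.Basic)
  have "?C \<in> sets ?K"
    by (rule occupation_in_sets[OF _ K t B]) (auto simp: space_measure_of_conv)
  then have C: "?C \<in> source_events M N start turn Clock" using G by (simp add: sets_measure_of)
  define E where "E i = (case i of Clock \<Rightarrow> ?C | Start \<Rightarrow> {\<omega> \<in> space M. start \<omega> = j}
    | Turn k \<Rightarrow> {\<omega> \<in> space M. turn k \<omega> = 2})" for i
  define J where "J = insert Clock (insert Start (Turn ` {..<n}))"
  have E: "\<forall>i\<in>J. E i \<in> source_events M N start turn i"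
  proof
    fix i assume "i \<in> J"
    show "E i \<in> source_events M N start turn i"
    proof (cases i)
      case Clock
      then show ?thesis using C by (simp add: E_def)
    next
      case Start
      then show ?thesis by (auto simp: E_def intro!: exI[of _ "{j}"])
    next
      case (Turn k)
      then show ?thesis by (auto simp: E_def intro!: exI[of _ "{2}"])
    qed
  qed
  have "prob (\<Inter>i\<in>J. E i) = (\<Prod>i\<in>J. prob (E i))"
    by (rule indep_setsD[OF sources_indep _ _ _ E]) (auto simp: J_def)
  also have "\<dots> = prob ?C * (prob (E Start) * (\<Prod>k<n. prob (E (Turn k))))"
  proof -
    have "inj_on Turn {..<n}" by (simp add: inj_on_def)
    then show ?thesis unfolding J_def by (subst prod.insert prod.reindex | force simp: E_def)+
  qed
  also have "\<dots> = prob ?C * ((1 - p - q) ^ n / 4)"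
    using prob_start[OF j] turn_reflection by (simp add: E_def)
  also have "(\<Inter>i\<in>J. E i) =
      {\<omega> \<in> space M. (N t \<omega> = n \<and> occupation f t \<omega> \<in> B) \<and> start \<omega> = j \<and> (\<forall>k<n. turn k \<omega> = 2)}"
    by (auto simp: J_def E_def)
  finally show ?thesis .
qed

end

subsection \<open>The planar motion on the axis\<close>

text \<open>The substitution is \<open>x = \<sigma> * (c * (2 * u - t))\<close>, with Jacobian
  \<open>1 / (2 * c)\<close>. Since \<open>A\<close> lies in the open interval,
  \<open>x \<in> A\<close> puts \<open>u\<close> into \<open>{0<..<t}\<close>, and that indicator
  drops out.\<close>

lemma nn_integral_axis_change:
  fixes b :: "real \<Rightarrow> real"
  assumes [measurable]: "b \<in> borel_measurable borel" "A \<in> sets borel" and A: "A \<subseteq> {- (c * t)<..<c * t}"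
    and c: "0 < c" and \<sigma>: "\<sigma> = 1 \<or> \<sigma> = - 1"
  shows "(\<integral>\<^sup>+u. indicator {0<..<t} u * ennreal (b u) * indicator {y. \<sigma> * (c * y) \<in> A} (2 * u - t) \<partial>lborel) =
    (\<integral>\<^sup>+x. ennreal (b (t / 2 + \<sigma> * x / (2 * c)) / (2 * c)) * indicator A x \<partial>lborel)"
proof -
  let ?f = "\<lambda>u. indicator {0<..<t} u * ennreal (b u) * indicator {y. \<sigma> * (c * y) \<in> A} (2 * u - t)"
  have [measurable]: "{y. \<sigma> * (c * y) \<in> A} \<in> sets borel"
    using measurable_sets[of "\<lambda>y. \<sigma> * (c * y)" borel borel A] by (simp add: vimage_def)
  have "(\<integral>\<^sup>+u. ?f u \<partial>lborel) =
    ennreal \<bar>\<sigma> / (2 * c)\<bar> * (\<integral>\<^sup>+x. ?f (t / 2 + \<sigma> / (2 * c) * x) \<partial>lborel)"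
    using c \<sigma> by (intro nn_integral_real_affine) auto
  also have "\<dots> = (\<integral>\<^sup>+x. ennreal \<bar>\<sigma> / (2 * c)\<bar> * ?f (t / 2 + \<sigma> / (2 * c) * x) \<partial>lborel)"
    by (rule nn_integral_cmult[symmetric]) measurable
  also have "\<dots> = (\<integral>\<^sup>+x. ennreal (b (t / 2 + \<sigma> * x / (2 * c)) / (2 * c)) * indicator A x \<partial>lborel)"
  proof (rule nn_integral_cong)
    fix x :: real
    have abs: "\<bar>\<sigma> / (2 * c)\<bar> = 1 / (2 * c)" using c \<sigma> by auto
    have eq: "\<sigma> * (c * (2 * (t / 2 + \<sigma> * x / (2 * c)) - t)) = x"
      using c \<sigma> by auto
    have in_range: "t / 2 + \<sigma> * x / (2 * c) \<in> {0<..<t}" if "x \<in> A"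
    proof -
      have "- (c * t) < x" "x < c * t" using that A by auto
      then show ?thesis using c \<sigma> by (auto simp: field_simps)
    qed
    show "ennreal \<bar>\<sigma> / (2 * c)\<bar> * ?f (t / 2 + \<sigma> / (2 * c) * x) =
      ennreal (b (t / 2 + \<sigma> * x / (2 * c)) / (2 * c)) * indicator A x"
    proof (cases "x \<in> A")
      case True
      have "ennreal (1 / (2 * c)) * ennreal (b (t / 2 + \<sigma> * x / (2 * c))) = ennreal (b (t / 2 + \<sigma> * x / (2 * c)) / (2 * c))"
        using c by (subst ennreal_mult'[symmetric]) auto
      then show ?thesis
        using True in_range[OF True] unfolding abs times_divide_eq_left
        by (simp only: indicator_def mem_Collect_eq eq of_bool_eq mult_1 mult_1_right)
    next
      case False
      then show ?thesis
        unfolding times_divide_eq_left by (simp only: indicator_def mem_Collect_eq eq of_bool_eq mult_zero_right)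
    qed
  qed
  finally show ?thesis .
qed

context planar_motion
begin

text \<open>The alternating occupation is measured relative to the starting direction; the sign that
  belongs to \<open>j\<close> is later put into the set \<open>B\<close>.\<close>

definition reflected :: "real \<Rightarrow> int \<Rightarrow> nat \<Rightarrow> real set \<Rightarrow> 'a set" where
  "reflected t j n B = {\<omega> \<in> space M. (N t \<omega> = n \<and> occupation (\<lambda>k. (- 1) ^ k) t \<omega> \<in> B) \<and>
    start \<omega> = j \<and> (\<forall>k<n. turn k \<omega> = 2)}"

lemma reflected_in_events:
  assumes "0 \<le> t" "B \<in> sets borel"
  shows "reflected t j n B \<in> events"
proof -
  note [measurable] = count_measurable[OF assms(1)] measurable_occupation[OF assms(1)] assms(2)
    start_measurable turn_measurable
  show ?thesis unfolding reflected_def by measurable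
qed

lemma index_reflected:
  assumes "\<omega> \<in> reflected t j n B" "k \<le> N t \<omega>"
  shows "index \<omega> k = j + 2 * int k"
proof -
  have "(\<Sum>i<k. turn i \<omega>) = (\<Sum>i<k. 2)"
    using assms by (intro sum.cong) (auto simp: reflected_def)
  then show ?thesis using assms(1) by (simp add: reflected_def)
qed

text \<open>Only counts \<open>Suc n\<close> occur: without any event a horizontal motion ends at
  \<open>c * t\<close> or \<open>- (c * t)\<close>, outside \<open>A\<close>. The signs
  \<open>1\<close> and \<open>- 1\<close> belong to the starts to the right and to the left.\<close>

lemma AE_axis_event:
  assumes rt: "0 < rate" and c: "0 < c" and t: "0 < t"
    and A: "A \<subseteq> {- (c * t)<..<c * t}"
  shows "AE \<omega> in M.
    (fst (position c N start turn t \<omega>) \<in> A \<and> snd (position c N start turn t \<omega>) = 0) \<longleftrightarrow>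
    (\<exists>n. \<omega> \<in> reflected t 0 (Suc n) {y. 1 * (c * y) \<in> A} \<union> reflected t 2 (Suc n) {y. - 1 * (c * y) \<in> A})"
proof -
  have "AE \<omega> in M. \<forall>k. turn k \<omega> \<in> {1, - 1, 2}"
    unfolding AE_all_countable using AE_turn by blast
  with AE_start AE_occupation_eq_0[OF rt t, of "\<lambda>m. sin (pi * of_int m / 2)"] AE_space
  show ?thesis
  proof eventually_elim
    case (elim \<omega>)
    have \<omega>: "\<omega> \<in> space M" using elim by blast
    note pos = position_eq[OF \<omega> less_imp_le[OF t], of c]
    \<comment> \<open>When even indices advance by \<open>2\<close>, the sines vanish and the
      cosines alternate, beginning with the sign of direction \<open>j\<close>.\<close>
    have key: "fst (position c N start turn t \<omega>) = (if j = 0 then 1 else - 1) * (c * occupation (\<lambda>k. (- 1) ^ k) t \<omega>) \<and>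
        snd (position c N start turn t \<omega>) = 0"
      if j: "j = 0 \<or> j = 2" and idx: "\<And>k. k \<le> N t \<omega> \<Longrightarrow> index \<omega> k = j + 2 * int k" for j
    proof -
      have "occupation (\<lambda>k. sin (pi * of_int (index \<omega> k) / 2)) t \<omega> = 0 * t"
        by (rule occupation_const[OF \<omega> less_imp_le[OF t]])
          (use idx j in \<open>auto simp only: sin_pi_half_int_eq_0_iff\<close>, auto)
      moreover have "occupation (\<lambda>k. cos (pi * of_int (index \<omega> k) / 2)) t \<omega> =
        occupation (\<lambda>k. (if j = 0 then 1 else - 1) * (- 1) ^ k) t \<omega>"
      proof (rule occupation_cong)
        fix k assume "k \<le> N t \<omega>"
        then show "cos (pi * of_int (index \<omega> k) / 2) = (if j = 0 then 1 else - 1) * (- 1) ^ k"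
          using idx[of k] j cos_pi_half_even[of k] cos_pi_half_even_shift[of k] by auto
      qed
      moreover have "occupation (\<lambda>k. (if j = 0 then 1 else - 1) * (- 1) ^ k) t \<omega> =
          (if j = 0 then 1 else - 1) * occupation (\<lambda>k. (- 1) ^ k) t \<omega>"
        unfolding occupation_def by (simp add: sum_distrib_left mult.assoc)
      ultimately show ?thesis unfolding pos by simp
    qed
    show ?case
    proof
      assume event: "fst (position c N start turn t \<omega>) \<in> A \<and> snd (position c N start turn t \<omega>) = 0"
      have even: "even (index \<omega> k)" if "k \<le> N t \<omega>" for k
      proof -
        have "occupation (\<lambda>k. sin (pi * of_int (index \<omega> k) / 2)) t \<omega> = 0"
          using event c unfolding pos by simp
        \<comment> \<open>The path \<open>index \<omega>\<close> depends on \<open>\<omega>\<close>;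
          the quantifier over all \<open>g\<close> inside the almost sure statement permits this
          instance.\<close>
        then have "sin (pi * of_int (index \<omega> k) / 2) = 0"
          using spec[OF elim(2), of "index \<omega>"] that by blast
        then show ?thesis by (simp only: sin_pi_half_int_eq_0_iff)
      qed
      have j: "start \<omega> = 0 \<or> start \<omega> = 2" using elim even[of 0] by auto
      \<comment> \<open>A turn between two even indices is even, and among the admissible turns only
        \<open>2\<close> is.\<close>
      have turn: "turn k \<omega> = 2" if "k < N t \<omega>" for k
      proof -
        have "index \<omega> (Suc k) = index \<omega> k + turn k \<omega>" by simp
        then have "even (turn k \<omega>)" using even[of k] even[of "Suc k"] that by (metis Suc_leI even_add less_imp_le)
        moreover have "turn k \<omega> \<in> {1, - 1, 2}" using elim by blast
        ultimately show ?thesis by auto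
      qed
      have mem: "\<omega> \<in> reflected t (start \<omega>) (N t \<omega>) {y. (if start \<omega> = 0 then 1 else - 1) * (c * y) \<in> A}"
      proof -
        have "\<omega> \<in> reflected t (start \<omega>) (N t \<omega>) UNIV" using \<omega> turn by (simp add: reflected_def)
        from key[OF j index_reflected[OF this]] event
        show ?thesis using \<omega> turn by (simp add: reflected_def)
      qed
      have "N t \<omega> \<noteq> 0"
      proof
        assume 0: "N t \<omega> = 0"
        have "occupation (\<lambda>k. (- 1) ^ k) t \<omega> = 1 * t"
          by (rule occupation_const[OF \<omega> less_imp_le[OF t]]) (simp add: 0)
        then have "c * t \<in> A \<or> - (c * t) \<in> A" using mem by (auto simp: reflected_def split: if_splits)
        then show False using A by auto
      qed
      then obtain n where "N t \<omega> = Suc n" using not0_implies_Suc by blast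
      then show "\<exists>n. \<omega> \<in> reflected t 0 (Suc n) {y. 1 * (c * y) \<in> A} \<union> reflected t 2 (Suc n) {y. - 1 * (c * y) \<in> A}"
        using mem j by (intro exI[of _ n]) auto
    next
      assume "\<exists>n. \<omega> \<in> reflected t 0 (Suc n) {y. 1 * (c * y) \<in> A} \<union> reflected t 2 (Suc n) {y. - 1 * (c * y) \<in> A}"
      then obtain n j where j: "j = 0 \<or> j = 2"
        and mem: "\<omega> \<in> reflected t j (Suc n) {y. (if j = 0 then 1 else - 1) * (c * y) \<in> A}"
        by fastforce
      from key[OF j index_reflected[OF mem]] mem
      show "fst (position c N start turn t \<omega>) \<in> A \<and> snd (position c N start turn t \<omega>) = 0"
        by (auto simp: reflected_def)
    qed
  qed
qed

text \<open>The denominator \<open>8 * c\<close> is \<open>4\<close>, from the uniform start, times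
  \<open>2 * c\<close>, from the change of variable.\<close>

lemma emeasure_reflected:
  assumes rt: "0 < rate" and c: "0 < c" and t: "0 < t" and r: "0 \<le> 1 - p - q"
    and A: "A \<in> sets borel" "A \<subseteq> {- (c * t)<..<c * t}"
    and \<sigma>: "\<sigma> = 1 \<or> \<sigma> = - 1" and j: "j \<in> {0, 1, 2, 3}"
  shows "emeasure M (reflected t j (Suc n) {y. \<sigma> * (c * y) \<in> A}) =
    (\<integral>\<^sup>+x. ennreal (rate ^ Suc n * exp (- rate * t) * (1 - p - q) ^ Suc n *
      beta_kernel (Suc n div 2) (n div 2) t (t / 2 + \<sigma> * x / (2 * c)) / (8 * c)) * indicator A x \<partial>lborel)"
proof -
  let ?B = "{y. \<sigma> * (c * y) \<in> A}" and ?b = "beta_kernel (Suc n div 2) (n div 2) t"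
  let ?K = "rate ^ Suc n * exp (- rate * t)" and ?r = "(1 - p - q) ^ Suc n / 4"
  have B: "?B \<in> sets borel"
    using measurable_sets[of "\<lambda>y. \<sigma> * (c * y)" borel borel A] A(1) by (simp add: vimage_def)
  have b[measurable]: "?b \<in> borel_measurable borel" by measurable
  note [measurable] = A(1)
  have nn: "0 \<le> ?K" "0 \<le> ?r" using rt r by (simp_all del: power_Suc)
  have "emeasure M (reflected t j (Suc n) ?B) =
    emeasure M {\<omega> \<in> space M. N t \<omega> = Suc n \<and> occupation (\<lambda>k. (- 1) ^ k) t \<omega> \<in> ?B} * ennreal ?r"
    unfolding reflected_def emeasure_eq_measure prob_reflections[OF less_imp_le[OF t] B j]
    using nn by (intro ennreal_mult) auto
  also have "emeasure M {\<omega> \<in> space M. N t \<omega> = Suc n \<and> occupation (\<lambda>k. (- 1) ^ k) t \<omega> \<in> ?B} =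
      ennreal ?K * (\<integral>\<^sup>+x. ennreal (?b (t / 2 + \<sigma> * x / (2 * c)) / (2 * c)) * indicator A x \<partial>lborel)"
    by (rule trans[OF alternating_occupation_law[OF rt t B]])
      (rule arg_cong[where f = "(*) (ennreal ?K)"], rule nn_integral_axis_change[OF b A c \<sigma>])
  also have "ennreal ?K * (\<integral>\<^sup>+x. ennreal (?b (t / 2 + \<sigma> * x / (2 * c)) / (2 * c)) * indicator A x \<partial>lborel) * ennreal ?r =
      ennreal (?K * ?r) * (\<integral>\<^sup>+x. ennreal (?b (t / 2 + \<sigma> * x / (2 * c)) / (2 * c)) * indicator A x \<partial>lborel)"
    unfolding ennreal_mult[OF nn] by (simp only: mult_ac)
  also have "\<dots> = (\<integral>\<^sup>+x. ennreal (?K * ?r) * (ennreal (?b (t / 2 + \<sigma> * x / (2 * c)) / (2 * c)) * indicator A x) \<partial>lborel)"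
    by (rule nn_integral_cmult[symmetric]) measurable
  also have "\<dots> = (\<integral>\<^sup>+x. ennreal (?K * (1 - p - q) ^ Suc n * ?b (t / 2 + \<sigma> * x / (2 * c)) / (8 * c)) * indicator A x \<partial>lborel)"
  proof (rule nn_integral_cong)
    fix x :: real
    have "ennreal (?K * ?r) * ennreal (?b (t / 2 + \<sigma> * x / (2 * c)) / (2 * c)) =
      ennreal (?K * ?r * (?b (t / 2 + \<sigma> * x / (2 * c)) / (2 * c)))"
      by (rule ennreal_mult'[OF mult_nonneg_nonneg[OF nn], symmetric])
    also have "?K * ?r * (?b (t / 2 + \<sigma> * x / (2 * c)) / (2 * c)) =
      ?K * (1 - p - q) ^ Suc n * ?b (t / 2 + \<sigma> * x / (2 * c)) / (8 * c)"
      by (simp del: power_Suc)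
    finally show "ennreal (?K * ?r) * (ennreal (?b (t / 2 + \<sigma> * x / (2 * c)) / (2 * c)) * indicator A x) =
      ennreal (?K * (1 - p - q) ^ Suc n * ?b (t / 2 + \<sigma> * x / (2 * c)) / (8 * c)) * indicator A x"
      by (simp only: mult.assoc[symmetric])
  qed
  finally show ?thesis .
qed

lemma emeasure_axis_event:
  assumes rt: "0 < rate" and c: "0 < c" and t: "0 < t" and r: "0 \<le> 1 - p - q"
    and A: "A \<in> sets borel" "A \<subseteq> {- (c * t)<..<c * t}"
  defines "S \<equiv> {\<omega> \<in> space M. fst (position c N start turn t \<omega>) \<in> A \<and> snd (position c N start turn t \<omega>) = 0}"
  shows "S \<in> events"
    and "(\<lambda>x. indicator A x * axis_density rate c p q x t) \<in> borel_measurable borel"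
    and "\<And>x. 0 \<le> indicator A x * axis_density rate c p q x t"
    and "emeasure M S = (\<integral>\<^sup>+x. ennreal (indicator A x * axis_density rate c p q x t) \<partial>lborel)"
proof -
  \<comment> \<open>\<open>T n\<close> collects both horizontal starts on
    \<open>N t = Suc n\<close>; they differ by the sign of \<open>x\<close>.\<close>
  define T where "T n x = rate ^ Suc n * exp (- rate * t) * (1 - p - q) ^ Suc n *
      (beta_kernel (Suc n div 2) (n div 2) t (t / 2 + x / (2 * c)) +
       beta_kernel (Suc n div 2) (n div 2) t (t / 2 - x / (2 * c))) / (8 * c)" for n x
  have T_meas[measurable]: "T n \<in> borel_measurable borel" for n
    unfolding T_def[abs_def] by measurable
  note [measurable] = A(1)
  have sums: "(\<lambda>n. indicator A x * T n x) sums (indicator A x * axis_density rate c p q x t)" for x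
  proof (cases "x \<in> A")
    case True
    then have "\<bar>x\<bar> < c * t" using subsetD[OF A(2)] by fastforce
    from axis_density_sums[OF c this, of rate p q] True show ?thesis by (simp add: T_def)
  qed simp
  have bounds: "0 \<le> t / 2 + x / (2 * c)" "t / 2 + x / (2 * c) \<le> t"
    "0 \<le> t / 2 - x / (2 * c)" "t / 2 - x / (2 * c) \<le> t" if "x \<in> A" for x
  proof -
    have "- (c * t) < x" "x < c * t" using that A(2) by auto
    then have "\<bar>x / (2 * c)\<bar> \<le> t / 2" using c by (simp add: abs_le_iff field_simps)
    then show "0 \<le> t / 2 + x / (2 * c)" "t / 2 + x / (2 * c) \<le> t"
      "0 \<le> t / 2 - x / (2 * c)" "t / 2 - x / (2 * c) \<le> t" by linarith+
  qed
  have T_nonneg: "0 \<le> indicator A x * T n x" for n x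
    using rt r c bounds[of x] by (cases "x \<in> A")
      (auto simp: T_def simp del: power_Suc intro!: divide_nonneg_nonneg mult_nonneg_nonneg add_nonneg_nonneg beta_kernel_nonneg)
  \<comment> \<open>The density contains a \<open>deriv\<close>; measurability, and then
    nonnegativity, are read off from the series instead.\<close>
  show meas: "(\<lambda>x. indicator A x * axis_density rate c p q x t) \<in> borel_measurable borel"
  proof -
    have "(\<lambda>x. \<Sum>n. indicator A x * T n x) \<in> borel_measurable borel" by measurable
    also have "(\<lambda>x. \<Sum>n. indicator A x * T n x) = (\<lambda>x. indicator A x * axis_density rate c p q x t)"
      by (rule ext) (rule sums_unique[OF sums, symmetric])
    finally show ?thesis .
  qed
  show nonneg: "0 \<le> indicator A x * axis_density rate c p q x t" for x
    using sums_le[OF _ sums_zero sums, of x] T_nonneg by blast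
  have pos_meas: "(\<lambda>\<omega>. fst (position c N start turn t \<omega>)) \<in> borel_measurable M"
    "(\<lambda>\<omega>. snd (position c N start turn t \<omega>)) \<in> borel_measurable M"
    using t measurable_occupation_index[of t "\<lambda>m. cos (pi * of_int m / 2)"]
      measurable_occupation_index[of t "\<lambda>m. sin (pi * of_int m / 2)"]
    by (simp_all add: position_eq cong: measurable_cong)
  show S: "S \<in> events"
  proof -
    note [measurable] = pos_meas
    have "{\<omega> \<in> space M. fst (position c N start turn t \<omega>) \<in> A \<and> snd (position c N start turn t \<omega>) \<in> {0}} \<in> events"
      by measurable
    then show ?thesis by (simp add: S_def)
  qed
  define E where "E j s n = reflected t j (Suc n) {y. s * (c * y) \<in> A}" for j :: int and s :: real and n
  have B: "{y. s * (c * y) \<in> A} \<in> sets borel" for s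
    using measurable_sets[of "\<lambda>y. s * (c * y)" borel borel A] by (simp add: vimage_def)
  have E: "E j s n \<in> events" for j s n
    unfolding E_def using t B by (intro reflected_in_events) auto
  have disj: "E 0 1 n \<inter> E 2 (- 1) n = {}" for n
    unfolding E_def reflected_def by fastforce
  have disj': "disjoint_family (\<lambda>n. E 0 1 n \<union> E 2 (- 1) n)"
    unfolding disjoint_family_on_def E_def reflected_def by fastforce
  have "emeasure M S = emeasure M (\<Union>n. E 0 1 n \<union> E 2 (- 1) n)"
  proof (rule emeasure_eq_AE)
    show "AE \<omega> in M. \<omega> \<in> S \<longleftrightarrow> \<omega> \<in> (\<Union>n. E 0 1 n \<union> E 2 (- 1) n)"
      using AE_axis_event[OF rt c t A(2)] AE_space
      by eventually_elim (simp add: S_def E_def)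
  qed (use S E in auto)
  also have "\<dots> = (\<Sum>n. emeasure M (E 0 1 n \<union> E 2 (- 1) n))"
    by (rule suminf_emeasure[OF _ disj', symmetric]) (use E in blast)
  also have "\<dots> = (\<Sum>n. \<integral>\<^sup>+x. ennreal (indicator A x * T n x) \<partial>lborel)"
  proof (intro suminf_cong)
    fix n
    let ?a = "rate ^ Suc n * exp (- rate * t) * (1 - p - q) ^ Suc n"
    let ?b = "beta_kernel (Suc n div 2) (n div 2) t"
    have "emeasure M (E 0 1 n \<union> E 2 (- 1) n) = emeasure M (E 0 1 n) + emeasure M (E 2 (- 1) n)"
      by (rule plus_emeasure[OF E E disj, symmetric])
    also have "\<dots> = (\<integral>\<^sup>+x. ennreal (?a * ?b (t / 2 + 1 * x / (2 * c)) / (8 * c)) * indicator A x \<partial>lborel) +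
      (\<integral>\<^sup>+x. ennreal (?a * ?b (t / 2 + - 1 * x / (2 * c)) / (8 * c)) * indicator A x \<partial>lborel)"
      unfolding E_def
      by (intro arg_cong2[where f = "(+)"] emeasure_reflected[OF rt c t r A]) auto
    also have "\<dots> = (\<integral>\<^sup>+x. ennreal (?a * ?b (t / 2 + 1 * x / (2 * c)) / (8 * c)) * indicator A x +
      ennreal (?a * ?b (t / 2 + - 1 * x / (2 * c)) / (8 * c)) * indicator A x \<partial>lborel)"
      by (rule nn_integral_add[symmetric]) measurable
    also have "\<dots> = (\<integral>\<^sup>+x. ennreal (indicator A x * T n x) \<partial>lborel)"
    proof (rule nn_integral_cong)
      fix x
      show "ennreal (?a * ?b (t / 2 + 1 * x / (2 * c)) / (8 * c)) * indicator A x +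
        ennreal (?a * ?b (t / 2 + - 1 * x / (2 * c)) / (8 * c)) * indicator A x = ennreal (indicator A x * T n x)"
      proof (cases "x \<in> A")
        case True
        have "0 \<le> ?a * ?b (t / 2 + x / (2 * c)) / (8 * c)" "0 \<le> ?a * ?b (t / 2 - x / (2 * c)) / (8 * c)"
          using rt r c bounds[OF True]
          by (auto simp del: power_Suc intro!: divide_nonneg_nonneg mult_nonneg_nonneg beta_kernel_nonneg)
        then show ?thesis
          using True by (simp add: T_def ennreal_plus[symmetric] add_divide_distrib distrib_left del: power_Suc ennreal_plus)
      qed simp
    qed
    finally show "emeasure M (E 0 1 n \<union> E 2 (- 1) n) = (\<integral>\<^sup>+x. ennreal (indicator A x * T n x) \<partial>lborel)" .
  qed
  also have "\<dots> = (\<integral>\<^sup>+x. (\<Sum>n. ennreal (indicator A x * T n x)) \<partial>lborel)"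
    by (rule nn_integral_suminf[symmetric]) measurable
  also have "\<dots> = (\<integral>\<^sup>+x. ennreal (indicator A x * axis_density rate c p q x t) \<partial>lborel)"
    by (intro nn_integral_cong suminf_ennreal_eq T_nonneg sums)
  finally show "emeasure M S = (\<integral>\<^sup>+x. ennreal (indicator A x * axis_density rate c p q x t) \<partial>lborel)" .
qed

end

theorem theorem4:
  fixes M :: "'a measure" and rate c p q t :: real
    and N :: "real \<Rightarrow> 'a \<Rightarrow> nat" and start :: "'a \<Rightarrow> int" and turn :: "nat \<Rightarrow> 'a \<Rightarrow> int"
  assumes "0 < rate" and "0 < c" and "0 \<le> p" and "0 \<le> q" and "p + q < 1"
    and "planar_motion M rate N p q start turn"
    and "0 < t"
  shows "\<forall>A \<in> sets borel. A \<subseteq> {- (c * t)<..<c * t} \<longrightarrow>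
    {\<omega> \<in> space M. fst (position c N start turn t \<omega>) \<in> A \<and> snd (position c N start turn t \<omega>) = 0}
      \<in> sets M \<and>
    set_integrable lborel A (\<lambda>x. axis_density rate c p q x t) \<and>
    measure M {\<omega> \<in> space M. fst (position c N start turn t \<omega>) \<in> A
        \<and> snd (position c N start turn t \<omega>) = 0}
      = (LINT x:A|lborel. axis_density rate c p q x t)"
proof (intro ballI impI)
  interpret planar_motion M rate N p q start turn by fact
  fix A :: "real set" assume A: "A \<in> sets borel" "A \<subseteq> {- (c * t)<..<c * t}"
  let ?S = "{\<omega> \<in> space M. fst (position c N start turn t \<omega>) \<in> A \<and> snd (position c N start turn t \<omega>) = 0}"
  let ?g = "\<lambda>x. indicator A x * axis_density rate c p q x t"
  have r: "0 \<le> 1 - p - q" using \<open>p + q < 1\<close> by simp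
  note axis = emeasure_axis_event[OF \<open>0 < rate\<close> \<open>0 < c\<close> \<open>0 < t\<close> r A]
  have g: "?g \<in> borel_measurable lborel" using axis(2) by simp
  \<comment> \<open>The nonnegative integral is a probability, hence finite: this yields
    integrability and the passage to the Lebesgue integral.\<close>
  have eq: "(\<integral>\<^sup>+x. ennreal (?g x) \<partial>lborel) = ennreal (prob ?S)"
    using axis(4) by (simp only: emeasure_eq_measure)
  have int: "integrable lborel ?g"
    by (rule integrableI_nn_integral_finite[OF g _ eq]) (use axis(3) in blast)
  have "(\<integral>x. ?g x \<partial>lborel) = enn2real (\<integral>\<^sup>+x. ennreal (?g x) \<partial>lborel)"
    by (rule integral_eq_nn_integral[OF g]) (use axis(3) in blast)
  then have "(\<integral>x. ?g x \<partial>lborel) = prob ?S" unfolding eq by simp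
  then show "?S \<in> sets M \<and> set_integrable lborel A (\<lambda>x. axis_density rate c p q x t) \<and>
    measure M ?S = (LINT x:A|lborel. axis_density rate c p q x t)"
    using axis(1) int by (simp add: set_integrable_def set_lebesgue_integral_def)
qed

end
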